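(* Let $\{x^{(k)}\}$ be the sequence generated by the scaled inertial forward-backward method with backtracking described in the context. Assume that, for some real $a>2$, $\theta_0=1$, $\beta_0=0$, and $\theta_k=\frac{a}{k+a}$, $\beta_k=\frac{k-1}{k+a}$ for $k\ge 1$. Assume that the scaling matrices $\{D_k\}\subset\mathcal{D}_\eta$ satisfy $\sup_{k}\|D_k\|=\gamma<\infty$ and, for all $k\ge 0$, $$D_{k+1}\preceq(1+\eta_k)D_k,\qquad D_k\preceq(1+\nu_k)D_{k+1},$$ where $\eta_k\ge 0$, $\nu_k\ge 0$ are real numbers with $\sum_{k=0}^\infty\eta_k<\infty$, $\sum_{k=0}^\infty\nu_k<\infty$, and $\eta_k=\mathcal{O}\left(\frac{1}{k^p}\right)$, $\nu_k=\mathcal{O}\left(\frac{1}{k^p}\right)$ with $p>2$. Then the sequence $\{x^{(k)}\}$ converges to a minimizer of $F$.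
   Context: Problem: minimize $F(x)=f(x)+g(x)$ over $x\in\mathbb{R}^n$, where $f,g:\mathbb{R}^n\to\mathbb{R}\cup\{\infty\}$ are proper, convex and lower semicontinuous; $Y\subseteq\mathbb{R}^n$ is closed and convex with $\mathrm{dom}(f)\supseteq Y\supseteq\mathrm{dom}(g)$ ($\mathrm{dom}$ is the set where the function is finite); $f$ is differentiable with $L$-Lipschitz continuous gradient on $Y$ ($L>0$); $g$ is bounded from below over its domain; the problem has at least one solution. Notation: $\|\cdot\|$ is the Euclidean norm (and induced matrix norm); $\|x\|_D^2=x^TDx$ for symmetric positive definite $D$; $D_1\succeq D_2$ (equivalently $D_2\preceq D_1$) means $x^TD_1x\ge x^TD_2x$ for all $x$. For $\eta>0$, $\mathcal{D}_\eta$ is the set of symmetric positive definite $n\times n$ real matrices $D$ with $D\succeq\eta I$. $P_{Y,D}(x)=\arg\min_{y\in Y}\|y-x\|_D^2$. For $x\in Y$, $y\in\mathbb{R}^n$: $\ell(y;x)=f(x)+\nabla f(x)^T(y-x)$. For $\alpha>0$, $D\in\mathcal{D}_\eta$, $x\in Y$: $p_{\alpha,D}(x)$ is the unique minimizer over $y\in\mathbb{R}^n$ of $\ell(y;x)+g(y)+\frac{1}{2\alpha}\|x-y\|_D^2$. Algorithm: fix an initial trial steplength $\alpha_{-1}>0$, $\delta\in(0,1)$, $x^{(0)}\in Y$, $x^{(-1)}=x^{(0)}$, nonnegative numbers $\{\beta_k\}_{k\ge0}$ and matrices $\{D_k\}_{k\ge 0}\subset\mathcal{D}_\eta$ with $\sup_k\|D_k\|<\infty$.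 For $k=0,1,2,\dots$: set $y^{(k)}=P_{Y,D_k}(x^{(k)}+\beta_k(x^{(k)}-x^{(k-1)}))$; let $\alpha_k=\delta^{i_k}\alpha_{k-1}$, where $i_k$ is the smallest nonnegative integer such that $x_+^{(k)}=p_{\alpha_k,D_k}(y^{(k)})$ satisfies $f(x_+^{(k)})\le\ell(x_+^{(k)};y^{(k)})+\frac{1}{2\alpha_k}\|y^{(k)}-x_+^{(k)}\|_{D_k}^2$; set $x^{(k+1)}=x_+^{(k)}$. *)

theory Defs
  imports "HOL-Analysis.Analysis" "HOL-Library.Landau_Symbols"
begin

definition edom :: "('a \<Rightarrow> ereal) \<Rightarrow> 'a set" where
  "edom f = {x. \<bar>f x\<bar> \<noteq> \<infinity>}"

definition proper_fun :: "('a \<Rightarrow> ereal) \<Rightarrow> bool" where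
  "proper_fun f \<longleftrightarrow> (\<forall>x. f x \<noteq> -\<infinity>) \<and> (\<exists>x. f x \<noteq> \<infinity>)"

text \<open>Only used for functions that never take the value \<open>-\<infinity>\<close>, so no \<open>\<infinity> - \<infinity>\<close> arises on the
  right-hand side; for weight \<open>0\<close> the convention \<open>0 * \<infinity> = 0\<close> of \<^typ>\<open>ereal\<close> makes the
  inequality trivial.\<close>

definition convex_fun :: "('a::real_vector \<Rightarrow> ereal) \<Rightarrow> bool" where
  "convex_fun f \<longleftrightarrow> (\<forall>x y. \<forall>u\<ge>0. \<forall>v\<ge>0. u + v = 1 \<longrightarrow>
     f (u *\<^sub>R x + v *\<^sub>R y) \<le> ereal u * f x + ereal v * f y)"

definition lsc_fun :: "('a::topological_space \<Rightarrow> ereal) \<Rightarrow> bool" where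
  "lsc_fun f \<longleftrightarrow> (\<forall>x. f x \<le> Liminf (at x) f)"

text \<open>\<open>G\<close> is a gradient of \<open>f\<close> at every point of \<open>Y\<close>. The derivative is taken within \<open>Y\<close>, so that
  \<open>Y\<close> may reach the boundary of \<^term>\<open>edom f\<close>; for \<open>Y \<subseteq> edom f\<close>, applying \<^const>\<open>real_of_ereal\<close>
  loses nothing, since only values of \<open>f\<close> on \<open>Y\<close> matter. If \<open>f\<close> is differentiable in a full
  neighbourhood sense at the points of \<open>Y\<close>, then its usual gradient satisfies this.\<close>

definition gradient_on :: "('a::real_inner \<Rightarrow> ereal) \<Rightarrow> ('a \<Rightarrow> 'a) \<Rightarrow> 'a set \<Rightarrow> bool" where
  "gradient_on f G Y \<longleftrightarrow>
     (\<forall>x\<in>Y. ((\<lambda>z. real_of_ereal (f z)) has_derivative (\<lambda>h. G x \<bullet> h)) (at x within Y))"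

definition loewner_le :: "real^'n^'n \<Rightarrow> real^'n^'n \<Rightarrow> bool"  (infix "\<preceq>" 50) where
  "A \<preceq> B \<longleftrightarrow> (\<forall>x. x \<bullet> (A *v x) \<le> x \<bullet> (B *v x))"

definition pos_def_matrix :: "real^'n^'n \<Rightarrow> bool" where
  "pos_def_matrix A \<longleftrightarrow> transpose A = A \<and> (\<forall>x. x \<noteq> 0 \<longrightarrow> 0 < x \<bullet> (A *v x))"

definition scaling_matrices :: "real \<Rightarrow> (real^'n^'n) set" where
  "scaling_matrices \<eta> = {D. pos_def_matrix D \<and> \<eta> *\<^sub>R mat 1 \<preceq> D}"

definition sq_norm :: "real^'n^'n \<Rightarrow> real^'n \<Rightarrow> real" where
  "sq_norm D x = x \<bullet> (D *v x)"

definition scaled_proj :: "(real^'n) set \<Rightarrow> real^'n^'n \<Rightarrow> real^'n \<Rightarrow> real^'n" where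
  "scaled_proj Y D x = arg_min_on (\<lambda>y. sq_norm D (y - x)) Y"

text \<open>\<open>lin f G y x\<close> is the linearisation of \<open>f\<close> at \<open>x\<close>, evaluated at \<open>y\<close>.\<close>

definition lin :: "(real^'n \<Rightarrow> ereal) \<Rightarrow> (real^'n \<Rightarrow> real^'n) \<Rightarrow> real^'n \<Rightarrow> real^'n \<Rightarrow> ereal" where
  "lin f G y x = f x + ereal (G x \<bullet> (y - x))"

definition fb_step ::
  "(real^'n \<Rightarrow> ereal) \<Rightarrow> (real^'n \<Rightarrow> real^'n) \<Rightarrow> (real^'n \<Rightarrow> ereal) \<Rightarrow> real \<Rightarrow> real^'n^'n
    \<Rightarrow> real^'n \<Rightarrow> real^'n" where
  "fb_step f G g \<alpha> D x =
     (ARG_MIN (\<lambda>y. lin f G y x + g y + ereal (1 / (2 * \<alpha>) * sq_norm D (x - y))) y. True)"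

definition sufficient_decrease ::
  "(real^'n \<Rightarrow> ereal) \<Rightarrow> (real^'n \<Rightarrow> real^'n) \<Rightarrow> (real^'n \<Rightarrow> ereal) \<Rightarrow> real \<Rightarrow> real^'n^'n
    \<Rightarrow> real^'n \<Rightarrow> bool" where
  "sufficient_decrease f G g \<alpha> D y \<longleftrightarrow>
     (let x' = fb_step f G g \<alpha> D y
      in f x' \<le> lin f G x' y + ereal (1 / (2 * \<alpha>) * sq_norm D (y - x')))"

text \<open>\<open>prev s\<^sub>0 s k\<close> is the term of index \<open>k - 1\<close> of the sequence \<open>s\<close>, where \<open>s\<^sub>0\<close> is the term of
  index \<open>-1\<close>.\<close>

definition prev :: "'a \<Rightarrow> (nat \<Rightarrow> 'a) \<Rightarrow> nat \<Rightarrow> 'a" where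
  "prev s\<^sub>0 s k = (case k of 0 \<Rightarrow> s\<^sub>0 | Suc j \<Rightarrow> s j)"

text \<open>\<open>\<alpha>\<^sub>0\<close> below is the initial trial steplength, of index \<open>-1\<close>. The equations determine \<open>y\<close>, \<open>\<alpha>\<close>
  and \<open>x\<close> recursively from \<open>x 0\<close>. Termination of the line search is not built in: it follows from
  the descent lemma when the gradient is Lipschitz on \<open>Y\<close>.\<close>

definition generated_by_SIFB ::
  "(real^'n \<Rightarrow> ereal) \<Rightarrow> (real^'n \<Rightarrow> real^'n) \<Rightarrow> (real^'n \<Rightarrow> ereal) \<Rightarrow> (real^'n) set
    \<Rightarrow> real \<Rightarrow> real \<Rightarrow> (nat \<Rightarrow> real) \<Rightarrow> (nat \<Rightarrow> real^'n^'n)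
    \<Rightarrow> (nat \<Rightarrow> real) \<Rightarrow> (nat \<Rightarrow> real^'n) \<Rightarrow> (nat \<Rightarrow> real^'n) \<Rightarrow> bool" where
  "generated_by_SIFB f G g Y \<alpha>\<^sub>0 \<delta> \<beta> D \<alpha> y x \<longleftrightarrow>
     x 0 \<in> Y \<and>
     (\<forall>k. y k = scaled_proj Y (D k) (x k + \<beta> k *\<^sub>R (x k - prev (x 0) x k)) \<and>
          \<alpha> k = \<delta> ^ (LEAST i. sufficient_decrease f G g (\<delta> ^ i * prev \<alpha>\<^sub>0 \<alpha> k) (D k) (y k))
                * prev \<alpha>\<^sub>0 \<alpha> k \<and>
          x (Suc k) = fb_step f G g (\<alpha> k) (D k) (y k))"

end

theory Submission
  imports Defs
begin

text \<open>Each forward-backward step satisfies a proximal inequality: for every \<open>z\<close> in the domain of \<open>g\<close>, the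
value of the objective \<open>f + g\<close> at the new iterate \<open>x'\<close>, multiplied by the steplength, plus half the
scaled squared distance from \<open>x'\<close> to \<open>z\<close>, is at most the same expression with \<open>z\<close> in the first
term and the inertial point in the second (\<open>fb_step_inequality\<close>, together with the
nonexpansiveness of the projection, \<open>scaled_proj_nonexpansive\<close>). The rest of the proof inserts three
competitors \<open>z\<close> into this one inequality.

A convex combination of the current iterate and a minimizer gives the energy estimate of accelerated
gradient methods (\<open>energy_step\<close>). Because the parameter \<open>a\<close> exceeds \<open>2\<close>, the energy loses at each
iteration a multiple of \<open>k\<close> times the distance of the objective to its minimum. Hence the iterates are
bounded and these weighted distances are summable.

The current iterate as competitor shows that the squared step lengths are summable with weight \<open>k\<close>
(\<open>summable_kinetic\<close>).

A minimizer as competitor bounds the increase of the squared distance to it by \<open>(k - 1) / (k + a)\<close>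
times the previous increase plus an error. The error consists of the squared step length and of the
changes of the scaling matrices, both summable with weight \<open>k\<close>; for the matrices this is what
the decay exponent \<open>p > 2\<close> is for. It follows that the squared distance to every minimizer
converges (\<open>convergent_sqdist\<close>), which forces the sequence to converge to any of its cluster
points (\<open>converges_to_minimizer\<close>).

In all three arguments the varying metric and the error terms enter through the recursion of
\<open>robbins_siegmund\<close>.\<close>

section \<open>Almost monotone sequences\<close>

text \<open>Dividing by the convergent product of the factors \<open>1 + r n\<close> removes them from the recursion. What is
left, corrected by the partial sums of \<open>e\<close> and of the rescaled \<open>c\<close>, is decreasing and bounded
below. The asymptotic estimates for the iterates all come from this lemma.\<close>

lemma robbins_siegmund:
  fixes S c e r :: "nat \<Rightarrow> real"
  assumes nonneg: "\<And>n. 0 \<le> S n" "\<And>n. 0 \<le> c n" "\<And>n. 0 \<le> e n" "\<And>n. 0 \<le> r n"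
    and sums: "summable r" "summable e"
    and rec: "\<And>n. S (Suc n) + c n \<le> (1 + r n) * (S n + e n)"
  shows "convergent S" and "summable c"
proof -
  define P where "P = (\<lambda>n. \<Prod>i<n. 1 + r i)"
  have P_Suc: "P (Suc n) = P n * (1 + r n)" for n
    by (simp add: P_def)
  have P_ge1: "1 \<le> P n" for n
    unfolding P_def by (rule prod_ge_1) (simp add: nonneg)
  have P_pos: "0 < P n" for n
    using P_ge1[of n] by linarith
  have P_inc: "incseq P"
  proof (rule incseq_SucI)
    show "P n \<le> P (Suc n)" for n
      using P_pos[of n] nonneg(4)[of n] by (simp add: P_Suc distrib_left)
  qed
  have P_le: "P n \<le> exp (suminf r)" for n
  proof -
    have "P n \<le> exp (\<Sum>i<n. r i)"
      unfolding P_def exp_sum[OF finite_lessThan]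
      by (intro prod_mono) (simp add: nonneg)
    also have "\<dots> \<le> exp (suminf r)"
      using sums nonneg by (auto intro: sum_le_suminf)
    finally show ?thesis .
  qed
  define q where "q = (\<lambda>n. c n / P (Suc n))"
  define U where "U = (\<lambda>n. S n / P n - (\<Sum>i<n. e i) + (\<Sum>i<n. q i))"
  have q_nonneg: "0 \<le> q n" for n
    unfolding q_def using nonneg P_pos by (simp add: less_imp_le)
  have step: "S (Suc n) / P (Suc n) + q n \<le> S n / P n + e n" for n
  proof -
    have "S (Suc n) / P (Suc n) + q n \<le> (1 + r n) * (S n + e n) / P (Suc n)"
      unfolding q_def add_divide_distrib[symmetric]
      using rec[of n] P_pos[of "Suc n"] by (simp add: divide_right_mono)
    also have "\<dots> = S n / P n + e n / P n"
      using P_pos[of n] nonneg(4)[of n] unfolding P_Suc by (simp add: field_simps add_nonneg_eq_0_iff)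
    also have "e n / P n \<le> e n"
      using nonneg(3)[of n] P_ge1[of n] P_pos[of n] by (simp add: divide_le_eq mult_le_cancel_left1)
    finally show ?thesis by simp
  qed
  have U_dec: "decseq U"
    using step by (intro decseq_SucI) (force simp: U_def algebra_simps)
  have e_le: "(\<Sum>i<n. e i) \<le> suminf e" for n
    using sums nonneg by (auto intro: sum_le_suminf)
  have U_ge: "(\<Sum>i<n. q i) - suminf e \<le> U n" for n
    using e_le[of n] divide_nonneg_pos[OF nonneg(1)[of n] P_pos[of n]] by (simp add: U_def)
  have "U n \<ge> - suminf e" for n
    using U_ge[of n] sum_nonneg[of "{..<n}" q] q_nonneg by force
  then have U_conv: "convergent U"
    using U_dec by (metis decseq_convergent convergentI)
  have "(\<Sum>i\<le>n. q i) \<le> U 0 + suminf e" for n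
    using U_ge[of "Suc n"] decseqD[OF U_dec, of 0 "Suc n"] by (simp add: lessThan_Suc_atMost)
  with q_nonneg have q_sum: "summable q" by (rule bounded_imp_summable)
  have "norm (c n) \<le> exp (suminf r) * q n" for n
  proof -
    have "c n = P (Suc n) * q n"
      unfolding q_def using P_pos[of "Suc n"] by simp
    also have "\<dots> \<le> exp (suminf r) * q n"
      using P_le q_nonneg by (intro mult_right_mono)
    finally show ?thesis using nonneg(2)[of n] by simp
  qed
  then show "summable c"
    by (rule summable_comparison_test'[OF summable_mult[OF q_sum], of 0])
  obtain p where p: "P \<longlonglongrightarrow> p"
    by (rule incseq_convergent[OF P_inc allI[OF P_le]]) (rule that)
  obtain u where u: "U \<longlonglongrightarrow> u"
    using U_conv by (auto simp: convergent_def)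
  have "(\<lambda>n. \<Sum>i<n. e i) \<longlonglongrightarrow> suminf e" "(\<lambda>n. \<Sum>i<n. q i) \<longlonglongrightarrow> suminf q"
    using sums(2) q_sum by (simp_all only: summable_LIMSEQ)
  then have "(\<lambda>n. P n * (U n + (\<Sum>i<n. e i) - (\<Sum>i<n. q i)))
      \<longlonglongrightarrow> p * (u + suminf e - suminf q)"
    by (intro tendsto_mult tendsto_diff tendsto_add p u)
  also have "(\<lambda>n. P n * (U n + (\<Sum>i<n. e i) - (\<Sum>i<n. q i))) = S"
  proof
    show "P n * (U n + (\<Sum>i<n. e i) - (\<Sum>i<n. q i)) = S n" for n
      using P_pos[of n] by (simp add: U_def)
  qed
  finally show "convergent S" by (rule convergentI)
qed

section \<open>The scaled norm\<close>

lemma sq_norm_add_scaleR: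
  assumes "transpose D = D"
  shows "sq_norm D (u + t *\<^sub>R w) = sq_norm D u + 2 * t * (u \<bullet> (D *v w)) + t\<^sup>2 * sq_norm D w"
proof -
  have "w \<bullet> (D *v u) = u \<bullet> (D *v w)"
    by (metis assms dot_lmul_matrix inner_commute transpose_matrix_vector)
  then show ?thesis
    by (simp add: sq_norm_def matrix_vector_right_distrib matrix_vector_mult_scaleR
        inner_simps algebra_simps power2_eq_square)
qed

lemma sq_norm_scaleR: "sq_norm D (t *\<^sub>R u) = t\<^sup>2 * sq_norm D u"
  by (simp add: sq_norm_def matrix_vector_mult_scaleR power2_eq_square)

lemma sq_norm_minus_commute: "sq_norm D (u - w) = sq_norm D (w - u)"
  using sq_norm_scaleR[of D "-1" "w - u"] by simp

section \<open>Convergence from the proximal inequality\<close>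

text \<open>All that the convergence proof uses of a forward-backward step is the inequality \<open>step\<close>, which compares one
iterate with an arbitrary competitor \<open>u\<close> in the domain \<open>C\<close> of the objective \<open>F\<close>. The sequence \<open>X\<close> is
the sequence of iterates without its starting point, where the objective may be infinite.
After this shift the inertial coefficient \<open>(k - 1) / (k + a)\<close> becomes \<open>n / (n + b)\<close> with
\<open>b = a + 1\<close>; it vanishes at \<open>n = 0\<close>, so the truncated index \<open>0 - 1\<close> does no harm.\<close>

locale scaled_inertial_sequence =
  fixes F :: "real^'n \<Rightarrow> real" and C :: "(real^'n) set" and X :: "nat \<Rightarrow> real^'n"
    and D :: "nat \<Rightarrow> real^'n^'n" and \<alpha> \<eta>s \<nu>s :: "nat \<Rightarrow> real" and b \<eta> \<gamma> \<alpha>\<^sub>m :: real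
  assumes b: "3 < b"
    and convex_F: "convex_on C F"
    and closed_sublevel: "\<And>c. closed {u \<in> C. F u \<le> c}"
    and sym_D: "\<And>n. transpose (D n) = D n"
    and \<eta>_pos: "0 < \<eta>"
    and D_lower: "\<And>n u. \<eta> * (norm u)\<^sup>2 \<le> sq_norm (D n) u"
    and D_upper: "\<And>n u. sq_norm (D n) u \<le> \<gamma> * (norm u)\<^sup>2"
    and D_growth: "\<And>n u. sq_norm (D (Suc n)) u \<le> (1 + \<eta>s n) * sq_norm (D n) u"
    and D_decay: "\<And>n u. sq_norm (D n) u \<le> (1 + \<nu>s n) * sq_norm (D (Suc n)) u"
    and \<eta>s: "\<And>n. 0 \<le> \<eta>s n" "summable (\<lambda>n. real (Suc n) * \<eta>s n)"
    and \<nu>s: "\<And>n. 0 \<le> \<nu>s n" "summable (\<lambda>n. real (Suc n) * \<nu>s n)"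
    and \<alpha>: "0 < \<alpha>\<^sub>m" "\<And>n. \<alpha>\<^sub>m \<le> \<alpha> n" "\<And>n. \<alpha> (Suc n) \<le> \<alpha> n"
    and X_in: "\<And>n. X n \<in> C"
    and step: "\<And>n u. u \<in> C \<Longrightarrow>
      \<alpha> n * F (X (Suc n)) + sq_norm (D n) (X (Suc n) - u) / 2
      \<le> \<alpha> n * F u + sq_norm (D n) (X n + (n / (n + b)) *\<^sub>R (X n - X (n - 1)) - u) / 2"
begin

lemma sq_norm_nonneg: "0 \<le> sq_norm (D n) u"
  using D_lower[of u n] \<eta>_pos by (smt (verit) mult_nonneg_nonneg zero_le_power2)

lemma \<alpha>_pos: "0 < \<alpha> n"
  using \<alpha>(1) \<alpha>(2)[of n] by linarith

lemma summable_\<eta>s: "summable \<eta>s"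
  by (rule summable_comparison_test'[OF \<eta>s(2), of 0]) (use \<eta>s(1) in \<open>simp add: algebra_simps\<close>)

definition minimizers :: "(real^'n) set" where
  "minimizers = {z \<in> C. \<forall>u\<in>C. F z \<le> F u}"

text \<open>The auxiliary sequence of accelerated gradient methods: with \<open>t n = (b - 1) / (n + b)\<close>, the iterate
\<open>X (Suc n)\<close> is the average of \<open>X n\<close> and \<open>extrapolate (Suc n)\<close> with weights \<open>1 - t n\<close> and \<open>t n\<close>.\<close>

definition extrapolate :: "nat \<Rightarrow> real^'n" where
  "extrapolate n = X n + (n / (b - 1)) *\<^sub>R (X n - X (n - 1))"

text \<open>Weighting by the steplength, which never increases, keeps ratios of consecutive steplengths out of
the recursions below.\<close>

definition gap :: "real^'n \<Rightarrow> nat \<Rightarrow> real" where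
  "gap z n = \<alpha> n * (F (X n) - F z)"

definition energy :: "real^'n \<Rightarrow> nat \<Rightarrow> real" where
  "energy z n = (n + b - 1)\<^sup>2 * gap z n + (b - 1)\<^sup>2 / 2 * sq_norm (D n) (extrapolate n - z)"

lemma gap_nonneg: "z \<in> minimizers \<Longrightarrow> 0 \<le> gap z n"
  using X_in \<alpha>_pos[of n] by (auto simp: gap_def minimizers_def)

lemma gap_Suc_le: "z \<in> minimizers \<Longrightarrow> gap z (Suc n) \<le> \<alpha> n * (F (X (Suc n)) - F z)"
  using X_in \<alpha>(3)[of n] by (auto simp: gap_def minimizers_def intro!: mult_right_mono)

lemma iterate_Suc_eq:
  defines "t \<equiv> \<lambda>n. (b - 1) / (real n + b)"
  shows "X (Suc n) = (1 - t n) *\<^sub>R X n + t n *\<^sub>R extrapolate (Suc n)"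
proof -
  define s where "s = real (Suc n) / (n + b)"
  have nb: "b - 1 \<noteq> 0" "n + b \<noteq> 0" using b by auto
  have "t n * (real (Suc n) / (b - 1)) = s" using nb by (simp add: t_def s_def)
  then have "t n *\<^sub>R extrapolate (Suc n) = t n *\<^sub>R X (Suc n) + s *\<^sub>R (X (Suc n) - X n)"
    unfolding extrapolate_def scaleR_add_right scaleR_scaleR by simp
  moreover have "t n = 1 - s" using nb by (simp add: t_def s_def field_simps)
  ultimately show ?thesis by (simp add: scaleR_diff_left scaleR_diff_right)
qed

text \<open>The competitor is \<open>w = (1 - t) X n + t z\<close>, chosen such that both displacements in \<open>step\<close> are \<open>t\<close>
times the displacement of an extrapolated point from \<open>z\<close>; multiplication by \<open>(n + b)\<^sup>2\<close> then makes
the weight of the quadratic terms independent of \<open>n\<close>. The weight \<open>(n + b) * (n + 1)\<close> of the old gap falls short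
of \<open>(n + b - 1)\<^sup>2\<close> by at least \<open>(b - 3) * (n + 1)\<close>, which is where \<open>b > 3\<close> gives a surplus that can be
summed.\<close>

lemma energy_step:
  assumes z: "z \<in> minimizers"
  shows "energy z (Suc n) + (b - 3) * (real (Suc n) * gap z n) \<le> (1 + \<eta>s n) * energy z n"
proof -
  define t where "t = (b - 1) / (n + b)"
  define w where "w = (1 - t) *\<^sub>R X n + t *\<^sub>R z"
  let ?V' = "\<alpha> n * (F (X (Suc n)) - F z)"
  let ?A' = "sq_norm (D n) (extrapolate (Suc n) - z)" and ?A = "sq_norm (D n) (extrapolate n - z)"
  have nb: "0 < n + b" "b - 1 \<noteq> 0" "n + b \<noteq> 0" using b by auto
  have t01: "0 \<le> t" "t \<le> 1" using b by (auto simp: t_def)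
  have zC: "z \<in> C" using z by (simp add: minimizers_def)
  have wC: "w \<in> C"
    unfolding w_def using convexD_alt[OF convex_on_imp_convex[OF convex_F] X_in zC t01] .
  have "F w \<le> (1 - t) * F (X n) + t * F z"
    unfolding w_def using convex_onD[OF convex_F t01 X_in zC] .
  then have Fw: "\<alpha> n * F w \<le> \<alpha> n * ((1 - t) * F (X n) + t * F z)"
    using \<alpha>_pos[of n] by simp
  have t_mult: "t * (m / (b - 1)) = m / (n + b)" for m
    using nb by (simp add: t_def)
  have dir': "X (Suc n) - w = t *\<^sub>R (extrapolate (Suc n) - z)"
    by (subst iterate_Suc_eq) (simp add: w_def t_def algebra_simps)
  have dir: "X n + (n / (n + b)) *\<^sub>R (X n - X (n - 1)) - w = t *\<^sub>R (extrapolate n - z)"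
    unfolding w_def extrapolate_def t_mult[of "real n", symmetric] by (simp add: algebra_simps)
  have "\<alpha> n * F (X (Suc n)) + t\<^sup>2 * ?A' / 2
      \<le> \<alpha> n * ((1 - t) * F (X n) + t * F z) + t\<^sup>2 * ?A / 2"
    using step[OF wC, of n] Fw unfolding dir dir' sq_norm_scaleR by linarith
  then have "?V' + t\<^sup>2 * ?A' / 2 \<le> (1 - t) * gap z n + t\<^sup>2 * ?A / 2"
    by (simp add: gap_def algebra_simps)
  then have "(n + b)\<^sup>2 * (?V' + t\<^sup>2 * ?A' / 2) \<le> (n + b)\<^sup>2 * ((1 - t) * gap z n + t\<^sup>2 * ?A / 2)"
    by (intro mult_left_mono) auto
  moreover have "(n + b)\<^sup>2 * t\<^sup>2 = (b - 1)\<^sup>2" "(n + b)\<^sup>2 * (1 - t) = (n + b) * real (Suc n)"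
  proof -
    have "(n + b) * t = b - 1" using nb by (simp add: t_def)
    then show "(n + b)\<^sup>2 * t\<^sup>2 = (b - 1)\<^sup>2" by (simp flip: power_mult_distrib)
    from \<open>(n + b) * t = b - 1\<close> have "(n + b) * (1 - t) = real (Suc n)"
      by (simp add: right_diff_distrib)
    then show "(n + b)\<^sup>2 * (1 - t) = (n + b) * real (Suc n)"
      by (simp only: power2_eq_square mult.assoc)
  qed
  ultimately have main: "(n + b)\<^sup>2 * ?V' + (b - 1)\<^sup>2 / 2 * ?A'
      \<le> (n + b) * real (Suc n) * gap z n + (b - 1)\<^sup>2 / 2 * ?A"
    by (simp add: distrib_left mult.assoc[symmetric])
  have coeff: "(n + b) * real (Suc n) + (b - 3) * real (Suc n) \<le> (n + b - 1)\<^sup>2"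
  proof -
    have "(n + b - 1)\<^sup>2 - ((n + b) * real (Suc n) + (b - 3) * real (Suc n)) = (b - 2)\<^sup>2"
      by (simp add: power2_eq_square algebra_simps)
    then show ?thesis using zero_le_power2[of "b - 2"] by linarith
  qed
  have "(b - 3) * (real (Suc n) * gap z n) + (n + b) * real (Suc n) * gap z n \<le> (n + b - 1)\<^sup>2 * gap z n"
    using mult_right_mono[OF coeff gap_nonneg[OF z, of n]] by (simp add: algebra_simps)
  with main have low: "(n + b)\<^sup>2 * ?V' + (b - 1)\<^sup>2 / 2 * ?A' + (b - 3) * (real (Suc n) * gap z n)
      \<le> energy z n"
    by (simp add: energy_def)
  have "energy z (Suc n) = (n + b)\<^sup>2 * gap z (Suc n)
      + (b - 1)\<^sup>2 / 2 * sq_norm (D (Suc n)) (extrapolate (Suc n) - z)"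
    by (simp add: energy_def add.commute)
  also have "\<dots> \<le> (n + b)\<^sup>2 * ?V' + (b - 1)\<^sup>2 / 2 * ((1 + \<eta>s n) * ?A')"
    by (intro add_mono mult_left_mono gap_Suc_le z D_growth) auto
  also have "\<dots> \<le> (1 + \<eta>s n) * ((n + b)\<^sup>2 * ?V' + (b - 1)\<^sup>2 / 2 * ?A')"
  proof -
    have "0 \<le> ?V'" using gap_Suc_le[OF z, of n] gap_nonneg[OF z, of "Suc n"] by linarith
    then have "0 \<le> \<eta>s n * ((n + b)\<^sup>2 * ?V')" using \<eta>s(1) by simp
    moreover have "A + c * ((1 + h) * s) \<le> (1 + h) * (A + c * s)" if "0 \<le> h * A" for A c h s :: real
      using that by (simp add: algebra_simps)
    ultimately show ?thesis by blast
  qed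
  also have "\<dots> \<le> (1 + \<eta>s n) * (energy z n - (b - 3) * (real (Suc n) * gap z n))"
    using low \<eta>s(1)[of n] by (intro mult_left_mono) auto
  also have "\<dots> \<le> (1 + \<eta>s n) * energy z n - (b - 3) * (real (Suc n) * gap z n)"
  proof -
    have "0 \<le> \<eta>s n * ((b - 3) * (real (Suc n) * gap z n))"
      using \<eta>s(1)[of n] b gap_nonneg[OF z, of n] by simp
    then show ?thesis by (simp add: algebra_simps)
  qed
  finally show ?thesis by simp
qed

lemma energy_nonneg: "z \<in> minimizers \<Longrightarrow> 0 \<le> energy z n"
  by (simp add: energy_def gap_nonneg sq_norm_nonneg)

lemma
  assumes z: "z \<in> minimizers"
  shows convergent_energy: "convergent (energy z)"
    and summable_gap: "summable (\<lambda>n. real (Suc n) * gap z n)"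
proof -
  have *: "0 \<le> (b - 3) * (real (Suc n) * gap z n)" for n
    using gap_nonneg[OF z, of n] b by simp
  note rs = robbins_siegmund[where S="energy z" and c="\<lambda>n. (b - 3) * (real (Suc n) * gap z n)"
      and e="\<lambda>_. 0" and r=\<eta>s, OF energy_nonneg[OF z] * _ \<eta>s(1) summable_\<eta>s]
  show "convergent (energy z)"
    by (rule rs) (use energy_step[OF z] in simp_all)
  have "summable (\<lambda>n. (b - 3) * (real (Suc n) * gap z n))"
    by (rule rs) (use energy_step[OF z] in simp_all)
  then show "summable (\<lambda>n. real (Suc n) * gap z n)"
    using b by (simp add: summable_cmult_iff)
qed

text \<open>The energy controls the extrapolated points, and the iterates are averages of those.\<close>

lemma iterates_near_minimizer:
  assumes z: "z \<in> minimizers"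
  obtains R where "\<And>n. norm (X n - z) \<le> R"
proof -
  obtain K where K: "\<And>n. norm (energy z n) \<le> K" 
    using convergent_imp_Bseq[OF convergent_energy[OF z]] by (elim BseqE) blast
  have "norm (extrapolate n - z) \<le> sqrt (K / ((b - 1)\<^sup>2 / 2 * \<eta>))" for n
  proof -
    have pos: "0 < (b - 1)\<^sup>2 / 2 * \<eta>" using b \<eta>_pos by simp
    have "(b - 1)\<^sup>2 / 2 * (\<eta> * (norm (extrapolate n - z))\<^sup>2)
        \<le> (b - 1)\<^sup>2 / 2 * sq_norm (D n) (extrapolate n - z)"
      by (intro mult_left_mono D_lower) simp
    also have "\<dots> \<le> energy z n" by (simp add: energy_def gap_nonneg[OF z])
    also have "\<dots> \<le> K" using K[of n] by simp
    finally have "(norm (extrapolate n - z))\<^sup>2 \<le> K / ((b - 1)\<^sup>2 / 2 * \<eta>)"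
      using pos by (simp add: field_simps)
    then show ?thesis by (rule real_le_rsqrt)
  qed
  then obtain R where R: "\<And>n. norm (extrapolate n - z) \<le> R" by blast
  have "norm (X n - z) \<le> R" for n
  proof (induction n)
    case 0
    show ?case using R[of 0] by (simp add: extrapolate_def)
  next
    case (Suc n)
    define t where "t = (b - 1) / (n + b)"
    have t01: "0 \<le> t" "t \<le> 1" using b by (auto simp: t_def)
    have "X (Suc n) - z = (1 - t) *\<^sub>R (X n - z) + t *\<^sub>R (extrapolate (Suc n) - z)"
      by (subst iterate_Suc_eq) (simp add: t_def algebra_simps)
    also have "norm \<dots> \<le> (1 - t) * norm (X n - z) + t * norm (extrapolate (Suc n) - z)"
      using t01 by (intro order.trans[OF norm_triangle_ineq]) simp
    also have "\<dots> \<le> (1 - t) * R + t * R"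
      using t01 Suc R by (intro add_mono mult_left_mono) auto
    finally show ?case by (simp add: algebra_simps)
  qed
  then show ?thesis using that by blast
qed

definition kinetic :: "nat \<Rightarrow> real" where
  "kinetic n = sq_norm (D n) (X n - X (n - 1)) / 2"

lemma kinetic_nonneg: "0 \<le> kinetic n"
  by (simp add: kinetic_def sq_norm_nonneg)

text \<open>Here the competitor is the current iterate, so the inertial displacement is the only one on the right.\<close>

lemma kinetic_step:
  assumes z: "z \<in> minimizers"
  shows "kinetic (Suc n) + gap z (Suc n)
    \<le> (1 + \<eta>s n) * (gap z n + (n / (n + b))\<^sup>2 * kinetic n)"
proof -
  let ?V' = "\<alpha> n * (F (X (Suc n)) - F z)" and ?A' = "sq_norm (D n) (X (Suc n) - X n) / 2"
  have V'0: "0 \<le> \<eta>s n * ?V'"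
    using gap_Suc_le[OF z, of n] gap_nonneg[OF z, of "Suc n"] \<eta>s(1)[of n] by simp
  have "kinetic (Suc n) + gap z (Suc n) \<le> (1 + \<eta>s n) * ?A' + ?V'"
    using D_growth[of n "X (Suc n) - X n"] gap_Suc_le[OF z, of n] by (simp add: kinetic_def)
  also have "\<dots> \<le> (1 + \<eta>s n) * (?V' + ?A')"
    using V'0 by (simp add: algebra_simps)
  also have "?V' + ?A' \<le> gap z n + (n / (n + b))\<^sup>2 * kinetic n"
  proof -
    have "sq_norm (D n) (X n + (n / (n + b)) *\<^sub>R (X n - X (n - 1)) - X n)
        = (n / (n + b))\<^sup>2 * (2 * kinetic n)"
      by (simp add: kinetic_def flip: sq_norm_scaleR)
    then show ?thesis
      using step[OF X_in, of n n] by (simp add: gap_def right_diff_distrib)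
  qed
  finally show ?thesis using \<eta>s(1)[of n] by (simp add: mult_left_mono)
qed

text \<open>With the weight \<open>(n + b - 1)\<^sup>2\<close>, damping wins over inertia: the kinetic term on the right has the
smaller weight \<open>n\<^sup>2\<close>, and the difference grows linearly in \<open>n\<close>. The growth of the weight on the gap is
linear in \<open>n\<close> as well, and is absorbed by the summability of the weighted gaps.\<close>

lemma summable_kinetic:
  assumes z: "z \<in> minimizers"
  shows "summable (\<lambda>n. real (Suc n) * kinetic n)"
proof -
  define S where "S n = (n + b - 1)\<^sup>2 * (kinetic n + gap z n)" for n
  define e where "e n = 2 * (n + b) * gap z n" for n
  have rec: "S (Suc n) + real (Suc n) * kinetic n \<le> (1 + \<eta>s n) * (S n + e n)" for n
  proof -
    have nb: "n + b \<noteq> 0" using b by auto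
    have "S (Suc n) = (n + b)\<^sup>2 * (kinetic (Suc n) + gap z (Suc n))"
      by (simp add: S_def add.commute)
    also have "\<dots> \<le> (n + b)\<^sup>2 * ((1 + \<eta>s n) * (gap z n + (n / (n + b))\<^sup>2 * kinetic n))"
      by (intro mult_left_mono kinetic_step[OF z]) auto
    also have "\<dots> = (1 + \<eta>s n) * ((n + b)\<^sup>2 * gap z n + (real n)\<^sup>2 * kinetic n)"
      using nb by (simp add: field_simps)
    also have "(n + b)\<^sup>2 * gap z n + (real n)\<^sup>2 * kinetic n \<le> S n + e n - real (Suc n) * kinetic n"
    proof -
      have "0 \<le> real n * (2 * b - 3)" "0 \<le> b * (b - 2)" using b by auto
      then have 1: "(real n)\<^sup>2 + real (Suc n) \<le> (n + b - 1)\<^sup>2"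
        by (simp add: power2_eq_square algebra_simps)
      have 2: "(n + b)\<^sup>2 \<le> (n + b - 1)\<^sup>2 + 2 * (n + b)"
        by (simp add: power2_eq_square algebra_simps)
      show ?thesis
        using mult_right_mono[OF 1 kinetic_nonneg[of n]] mult_right_mono[OF 2 gap_nonneg[OF z, of n]]
        by (simp add: S_def e_def algebra_simps)
    qed
    also have "(1 + \<eta>s n) * (S n + e n - real (Suc n) * kinetic n)
        \<le> (1 + \<eta>s n) * (S n + e n) - real (Suc n) * kinetic n"
    proof -
      have "0 \<le> \<eta>s n * (real (Suc n) * kinetic n)"
        using \<eta>s(1)[of n] kinetic_nonneg[of n] by simp
      then show ?thesis by (simp add: algebra_simps)
    qed
    finally show ?thesis using \<eta>s(1)[of n] by (simp add: mult_left_mono)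
  qed
  have e_sum: "summable e"
  proof (rule summable_comparison_test'[of "\<lambda>n. 2 * b * (real (Suc n) * gap z n)" 0])
    show "summable (\<lambda>n. 2 * b * (real (Suc n) * gap z n))"
      by (intro summable_mult summable_gap z)
    fix n
    have "1 * real n \<le> b * real n" using b by (intro mult_right_mono) auto
    then have "n + b \<le> b * real (Suc n)" by (simp add: algebra_simps)
    then have "(n + b) * gap z n \<le> b * real (Suc n) * gap z n"
      by (intro mult_right_mono gap_nonneg z)
    then have "e n \<le> 2 * b * (real (Suc n) * gap z n)" by (simp add: e_def algebra_simps)
    moreover have "0 \<le> e n" using b gap_nonneg[OF z, of n] by (simp add: e_def)
    ultimately show "norm (e n) \<le> 2 * b * (real (Suc n) * gap z n)" by simp
  qed
  show ?thesis
  proof (rule robbins_siegmund(2)[OF _ _ _ \<eta>s(1) summable_\<eta>s e_sum rec])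
    show "0 \<le> S n" for n using kinetic_nonneg[of n] gap_nonneg[OF z, of n] by (simp add: S_def)
    show "0 \<le> real (Suc n) * kinetic n" for n using kinetic_nonneg[of n] by simp
    show "0 \<le> e n" for n using gap_nonneg[OF z, of n] b by (simp add: e_def)
  qed
qed

definition sqdist :: "real^'n \<Rightarrow> nat \<Rightarrow> real" where
  "sqdist z n = sq_norm (D n) (X n - z) / 2"

lemma sqdist_nonneg: "0 \<le> sqdist z n"
  by (simp add: sqdist_def sq_norm_nonneg)

text \<open>The competitor is the minimizer itself, so the function values drop out. Expanding the square of the
inertial point turns the cross term into a difference of two squared distances.\<close>

lemma sqdist_step:
  assumes z: "z \<in> minimizers"
  defines "\<beta> \<equiv> \<lambda>n. real n / (n + b)"
  shows "sqdist z (Suc n) \<le> (1 + \<eta>s n) * (sqdist z n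
    + \<beta> n * (sqdist z n - sq_norm (D n) (X (n - 1) - z) / 2) + 2 * kinetic n)"
proof -
  let ?d = "X n - X (n - 1)"
  have \<beta>: "0 \<le> \<beta> n" "\<beta> n \<le> 1" using b by (auto simp: \<beta>_def)
  have zC: "z \<in> C" and le: "F z \<le> F (X (Suc n))" using z X_in by (auto simp: minimizers_def)
  have "sq_norm (D n) (X (Suc n) - z) / 2 \<le> sq_norm (D n) ((X n - z) + \<beta> n *\<^sub>R ?d) / 2"
  proof -
    have "X n + \<beta> n *\<^sub>R ?d - z = (X n - z) + \<beta> n *\<^sub>R ?d" by (simp only: diff_add_eq)
    moreover have "\<alpha> n * F z \<le> \<alpha> n * F (X (Suc n))" using le \<alpha>_pos[of n] by simp
    moreover have "\<alpha> n * F (X (Suc n)) + sq_norm (D n) (X (Suc n) - z) / 2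
        \<le> \<alpha> n * F z + sq_norm (D n) (X n + \<beta> n *\<^sub>R ?d - z) / 2"
      using step[OF zC, of n] by (simp only: \<beta>_def)
    ultimately show ?thesis by (smt (verit) divide_right_mono)
  qed
  also have "\<dots> = sqdist z n + \<beta> n * ((X n - z) \<bullet> (D n *v ?d)) + (\<beta> n)\<^sup>2 * kinetic n"
    unfolding sq_norm_add_scaleR[OF sym_D]
    by (simp add: sqdist_def kinetic_def add_divide_distrib)
  also have "(X n - z) \<bullet> (D n *v ?d) = sqdist z n - sq_norm (D n) (X (n - 1) - z) / 2 + kinetic n"
  proof -
    have "X (n - 1) - z = (X n - z) + (- 1) *\<^sub>R ?d" by simp
    then show ?thesis
      using sq_norm_add_scaleR[OF sym_D, of n "X n - z" "- 1" ?d]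
      by (simp add: sqdist_def kinetic_def add_divide_distrib diff_divide_distrib)
  qed
  also have "sqdist z n + \<beta> n * (sqdist z n - sq_norm (D n) (X (n - 1) - z) / 2 + kinetic n)
      + (\<beta> n)\<^sup>2 * kinetic n
      \<le> sqdist z n + \<beta> n * (sqdist z n - sq_norm (D n) (X (n - 1) - z) / 2) + 2 * kinetic n"
  proof -
    have "\<beta> n * kinetic n \<le> 1 * kinetic n" "(\<beta> n)\<^sup>2 * kinetic n \<le> 1 * kinetic n"
      using \<beta> kinetic_nonneg[of n] by (simp_all add: mult_left_le_one_le power_le_one)
    then show ?thesis by (simp add: algebra_simps)
  qed
  finally have "(1 + \<eta>s n) * (sq_norm (D n) (X (Suc n) - z) / 2) \<le> (1 + \<eta>s n) * (sqdist z n
      + \<beta> n * (sqdist z n - sq_norm (D n) (X (n - 1) - z) / 2) + 2 * kinetic n)"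
    using \<eta>s(1)[of n] by (intro mult_left_mono) auto
  then show ?thesis
    using D_growth[of n "X (Suc n) - z"] by (simp add: sqdist_def)
qed

text \<open>The positive parts \<open>\<delta> n\<close> of the increments of the squared distance contract by the inertial factor, up
to an error \<open>e n\<close> made of the kinetic term and of the changes of the scaling matrices. As one minus
the factor is only of order \<open>1 / n\<close>, summability of \<open>\<delta>\<close> needs summability of \<open>n * e n\<close>; this is why the
changes of the matrices have to be summable with weight \<open>n\<close>. A sequence that is bounded below and has
summable positive increments converges.\<close>

lemma convergent_sqdist:
  assumes z: "z \<in> minimizers"
  shows "convergent (sqdist z)"
proof -
  obtain R where R: "\<And>n. norm (X n - z) \<le> R" using iterates_near_minimizer[OF z] by blast
  have R0: "0 \<le> R" using R[of 0] norm_ge_zero order.trans by blast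
  define M where "M = \<bar>\<gamma>\<bar> * (2 * R)\<^sup>2"
  have sq_le: "sq_norm (D n) u \<le> M" if "norm u \<le> 2 * R" for n u
  proof -
    have "sq_norm (D n) u \<le> \<bar>\<gamma>\<bar> * (norm u)\<^sup>2"
      using D_upper[of n u] by (smt (verit) mult_right_mono zero_le_power2)
    also have "\<dots> \<le> M" unfolding M_def using that by (intro mult_left_mono power_mono) auto
    finally show ?thesis .
  qed
  have sqdist_le: "sqdist z n \<le> M" and prev_le: "sq_norm (D n) (X (n - 1) - z) / 2 \<le> M" for n
    using sq_le[of "X n - z" n] sq_le[of "X (n - 1) - z" n] R[of n] R[of "n - 1"] R0
      sq_norm_nonneg[of n "X n - z"] sq_norm_nonneg[of n "X (n - 1) - z"]
    by (auto simp: sqdist_def)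
  have kin_le: "kinetic n \<le> M" for n
  proof -
    have "norm (X n - X (n - 1)) \<le> 2 * R"
      using norm_triangle_ineq4[of "X n - z" "X (n - 1) - z"] R[of n] R[of "n - 1"] by simp
    then show ?thesis
      using sq_le[of "X n - X (n - 1)" n] sq_norm_nonneg[of n "X n - X (n - 1)"]
      by (simp add: kinetic_def)
  qed
  have M0: "0 \<le> M" by (simp add: M_def)
  define \<delta> where "\<delta> n = max 0 (sqdist z (Suc n) - sqdist z n)" for n
  define e where "e n = 4 * M * \<eta>s (Suc n) + M * \<nu>s n + 2 * kinetic (Suc n)" for n
  have e_nonneg: "0 \<le> e n" for n
    using M0 \<eta>s(1) \<nu>s(1) kinetic_nonneg by (simp add: e_def)
  have \<delta>_step: "\<delta> (Suc n) \<le> Suc n / (Suc n + b) * \<delta> n + e n" for n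
  proof -
    let ?\<beta> = "Suc n / (Suc n + b)" and ?P = "sqdist z (Suc n)" and ?k = "kinetic (Suc n)"
    let ?Q = "sq_norm (D (Suc n)) (X n - z) / 2"
    have \<beta>: "0 \<le> ?\<beta>" "?\<beta> \<le> 1" using b by auto
    have Q: "0 \<le> ?Q" "?Q \<le> M" using sq_norm_nonneg prev_le[of "Suc n"] by auto
    have "sqdist z n \<le> ?Q + \<nu>s n * ?Q"
      using D_decay[of n "X n - z"] by (simp add: sqdist_def algebra_simps)
    also have "\<nu>s n * ?Q \<le> \<nu>s n * M" using Q \<nu>s(1) by (intro mult_left_mono) auto
    finally have "?P - ?Q \<le> ?P - sqdist z n + M * \<nu>s n" by (simp add: mult.commute)
    also have "\<dots> \<le> \<delta> n + M * \<nu>s n" by (simp add: \<delta>_def)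
    finally have "?\<beta> * (?P - ?Q) \<le> ?\<beta> * (\<delta> n + M * \<nu>s n)"
      using \<beta> by (intro mult_left_mono)
    also have "\<dots> \<le> ?\<beta> * \<delta> n + M * \<nu>s n"
    proof -
      have "?\<beta> * (M * \<nu>s n) \<le> 1 * (M * \<nu>s n)"
        using \<beta> M0 \<nu>s(1)[of n] by (intro mult_right_mono) auto
      then show ?thesis by (simp add: distrib_left)
    qed
    finally have 1: "?\<beta> * (?P - ?Q) \<le> ?\<beta> * \<delta> n + M * \<nu>s n" .
    have "?\<beta> * (?P - ?Q) \<le> 1 * ?P"
    proof -
      have "?\<beta> * (?P - ?Q) \<le> ?\<beta> * ?P" using \<beta> Q by (intro mult_left_mono) auto
      also have "\<dots> \<le> 1 * ?P" using \<beta> sqdist_nonneg by (intro mult_right_mono)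
      finally show ?thesis .
    qed
    then have "?P + ?\<beta> * (?P - ?Q) + 2 * ?k \<le> 4 * M"
      using sqdist_le[of "Suc n"] kin_le[of "Suc n"] by linarith
    then have "\<eta>s (Suc n) * (?P + ?\<beta> * (?P - ?Q) + 2 * ?k) \<le> \<eta>s (Suc n) * (4 * M)"
      using \<eta>s(1) by (intro mult_left_mono)
    then have "sqdist z (Suc (Suc n)) - ?P \<le> ?\<beta> * (?P - ?Q) + 2 * ?k + 4 * M * \<eta>s (Suc n)"
      using sqdist_step[OF z, of "Suc n"] unfolding distrib_right[of 1]
      by (simp add: mult.commute)
    with 1 have "sqdist z (Suc (Suc n)) - ?P \<le> ?\<beta> * \<delta> n + e n" by (simp add: e_def)
    moreover have "0 \<le> ?\<beta> * \<delta> n" using \<beta>(1) by (rule mult_nonneg_nonneg) (simp add: \<delta>_def)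
    ultimately show ?thesis using e_nonneg[of n] by (simp add: \<delta>_def)
  qed
  have shift: "summable (\<lambda>n. real (Suc (Suc n)) * s (Suc n))"
    if "summable (\<lambda>n. real (Suc n) * s n)" for s :: "nat \<Rightarrow> real"
    using that summable_Suc_iff[of "\<lambda>n. real (Suc n) * s n"] by simp
  have "summable (\<lambda>n. real (Suc n) * e n)"
  proof (rule summable_comparison_test'[where N=0])
    show "summable (\<lambda>n. 4 * M * (real (Suc (Suc n)) * \<eta>s (Suc n)) + M * (real (Suc n) * \<nu>s n)
        + 2 * (real (Suc (Suc n)) * kinetic (Suc n)))"
      by (intro summable_add summable_mult shift \<eta>s(2) \<nu>s(2) summable_kinetic[OF z])
    fix n
    have "0 \<le> M * \<eta>s (Suc n)" using M0 \<eta>s(1) by simp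
    then have "real (Suc n) * e n \<le> 4 * M * (real (Suc (Suc n)) * \<eta>s (Suc n))
        + M * (real (Suc n) * \<nu>s n) + 2 * (real (Suc (Suc n)) * kinetic (Suc n))"
      using kinetic_nonneg[of "Suc n"] by (simp add: e_def algebra_simps)
    moreover have "0 \<le> real (Suc n) * e n" using e_nonneg[of n] by simp
    ultimately show "norm (real (Suc n) * e n) \<le> 4 * M * (real (Suc (Suc n)) * \<eta>s (Suc n))
        + M * (real (Suc n) * \<nu>s n) + 2 * (real (Suc (Suc n)) * kinetic (Suc n))" by simp
  qed
  then have we: "summable (\<lambda>n. (1 + b) * (real (Suc n) * e n))" by (rule summable_mult)
  have \<delta>_sum: "summable \<delta>"
  proof (rule robbins_siegmund(2)[where r="\<lambda>_. 0" and S="\<lambda>n. (n + b) * \<delta> n"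
        and e="\<lambda>n. (1 + b) * (real (Suc n) * e n)"])
    fix n
    show "0 \<le> (n + b) * \<delta> n" using b by (simp add: \<delta>_def)
    show "0 \<le> \<delta> n" by (simp add: \<delta>_def)
    show "0 \<le> (1 + b) * (real (Suc n) * e n)" using b e_nonneg[of n] by simp
    have "(Suc n + b) * \<delta> (Suc n) \<le> (Suc n + b) * (Suc n / (Suc n + b) * \<delta> n + e n)"
      using b by (intro mult_left_mono \<delta>_step) auto
    also have "\<dots> = Suc n * \<delta> n + (Suc n + b) * e n"
    proof -
      have "real (Suc n) + b \<noteq> 0" using b by auto
      then show ?thesis by (simp add: distrib_left)
    qed
    finally have 1: "(Suc n + b) * \<delta> (Suc n) \<le> Suc n * \<delta> n + (Suc n + b) * e n" .
    have 2: "(Suc n + b) * e n \<le> (1 + b) * Suc n * e n"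
      using b e_nonneg[of n] by (intro mult_right_mono) (auto simp: algebra_simps)
    \<comment> \<open>The factor \<open>(n + 1) / (n + 1 + b)\<close> shrinks the weight of \<open>\<delta> n\<close> from \<open>n + b\<close> to \<open>n + 1\<close>; of the surplus \<open>b - 1\<close> only \<open>1\<close> is kept.\<close>
    have 3: "(real (Suc n) + 1) * \<delta> n \<le> (n + b) * \<delta> n"
      using b by (intro mult_right_mono) (auto simp: \<delta>_def)
    show "(Suc n + b) * \<delta> (Suc n) + \<delta> n
        \<le> (1 + 0) * ((n + b) * \<delta> n + (1 + b) * (real (Suc n) * e n))"
      using 1 2 3 by (simp add: algebra_simps)
  qed (use we in auto)
  show ?thesis
    by (rule robbins_siegmund(1)[where r="\<lambda>_. 0" and c="\<lambda>_. 0" and e=\<delta>])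
       (use \<delta>_sum sqdist_nonneg in \<open>auto simp: \<delta>_def\<close>)
qed

text \<open>A cluster point of the bounded sequence is a minimizer, since the objective values tend to the minimum
and the sublevel sets are closed. The squared distance to this particular minimizer converges, and
along a subsequence it tends to \<open>0\<close>; hence the whole sequence converges to it.\<close>

theorem converges_to_minimizer:
  assumes "minimizers \<noteq> {}"
  obtains l where "l \<in> minimizers" "X \<longlonglongrightarrow> l"
proof -
  obtain z where z: "z \<in> minimizers" using assms by blast
  then have zC: "z \<in> C" and z_min: "\<And>u. u \<in> C \<Longrightarrow> F z \<le> F u" by (auto simp: minimizers_def)
  obtain R where "\<And>n. norm (X n - z) \<le> R" using iterates_near_minimizer[OF z] by blast
  then have "bounded (range X)"
    by (intro boundedI[of _ "R + norm z"]) (smt (verit) norm_triangle_sub rangeE)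
  then obtain l r where r: "strict_mono r" and lim: "(X \<circ> r) \<longlonglongrightarrow> l"
    using bounded_imp_convergent_subsequence by blast
  have "(\<lambda>n. F (X n) - F z) \<longlonglongrightarrow> 0"
  proof (rule tendsto_sandwich[where f="\<lambda>_. 0" and h="\<lambda>n. real (Suc n) * gap z n / \<alpha>\<^sub>m"])
    show "\<forall>\<^sub>F n in sequentially. 0 \<le> F (X n) - F z" using z_min X_in by simp
    have "F (X n) - F z \<le> real (Suc n) * gap z n / \<alpha>\<^sub>m" for n
    proof -
      have "\<alpha>\<^sub>m * (F (X n) - F z) \<le> gap z n"
        unfolding gap_def using \<alpha>(2) z_min[OF X_in[of n]] by (intro mult_right_mono) auto
      also have "\<dots> \<le> real (Suc n) * gap z n"
        using gap_nonneg[OF z, of n] by (simp add: algebra_simps)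
      finally show ?thesis using \<alpha>(1) by (simp add: field_simps)
    qed
    then show "\<forall>\<^sub>F n in sequentially. F (X n) - F z \<le> real (Suc n) * gap z n / \<alpha>\<^sub>m" by simp
    show "(\<lambda>n. real (Suc n) * gap z n / \<alpha>\<^sub>m) \<longlonglongrightarrow> 0"
      using summable_LIMSEQ_zero[OF summable_gap[OF z]] by (intro tendsto_divide_zero)
  qed simp
  then have FX: "(\<lambda>n. F (X n)) \<longlonglongrightarrow> F z" by (rule LIM_zero_cancel)
  have "l \<in> {u \<in> C. F u \<le> c}" if "F z < c" for c
  proof (rule Lim_in_closed_set[OF closed_sublevel _ _ lim])
    have "\<forall>\<^sub>F n in sequentially. F (X n) < c" using order_tendstoD(2)[OF FX that] .
    then show "\<forall>\<^sub>F n in sequentially. (X \<circ> r) n \<in> {u \<in> C. F u \<le> c}"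
      by (rule eventually_subseq[OF r, THEN eventually_mono]) (auto simp: X_in)
  qed simp
  then have "l \<in> C" "F l \<le> F z" using gt_ex[of "F z"] by (auto intro: dense_ge)
  then have l: "l \<in> minimizers" using z_min by (force simp: minimizers_def)
  have "(sqdist l \<circ> r) \<longlonglongrightarrow> 0"
  proof (rule tendsto_sandwich[where f="\<lambda>_. 0" and h="\<lambda>n. \<gamma> * (norm ((X \<circ> r) n - l))\<^sup>2 / 2"])
    have "(\<lambda>n. \<gamma> * (norm ((X \<circ> r) n - l))\<^sup>2 / 2) \<longlonglongrightarrow> \<gamma> * (norm (l - l))\<^sup>2 / 2"
      by (intro tendsto_intros lim) simp
    then show "(\<lambda>n. \<gamma> * (norm ((X \<circ> r) n - l))\<^sup>2 / 2) \<longlonglongrightarrow> 0" by simp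
  qed (use sqdist_nonneg D_upper in \<open>auto simp: sqdist_def\<close>)
  moreover obtain s where s: "sqdist l \<longlonglongrightarrow> s" using convergent_sqdist[OF l] by (auto simp: convergent_def)
  ultimately have "sqdist l \<longlonglongrightarrow> 0"
    using LIMSEQ_subseq_LIMSEQ[OF s r] LIMSEQ_unique by blast
  then have "(\<lambda>n. sqrt (2 * sqdist l n / \<eta>)) \<longlonglongrightarrow> sqrt (2 * 0 / \<eta>)"
    by (intro tendsto_intros) (use \<eta>_pos in auto)
  then have "(\<lambda>n. sqrt (2 * sqdist l n / \<eta>)) \<longlonglongrightarrow> 0" by simp
  moreover have "norm (X n - l) \<le> sqrt (2 * sqdist l n / \<eta>)" for n
    using D_lower[of "X n - l" n] \<eta>_pos by (intro real_le_rsqrt) (simp add: sqdist_def field_simps)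
  ultimately have "(\<lambda>n. X n - l) \<longlonglongrightarrow> 0"
    by (intro Lim_null_comparison[where f="\<lambda>n. X n - l" and g="\<lambda>n. sqrt (2 * sqdist l n / \<eta>)"]) auto
  then show ?thesis using that l LIM_zero_cancel by blast
qed

end

section \<open>Minimizers, projections and proximal points\<close>

text \<open>The sublevel sets form a chain, so finitely many of them have a common point; by compactness all of
them do.\<close>

lemma ex_minimizer_compact_sublevel:
  fixes h :: "'a::topological_space \<Rightarrow> 'b::linorder"
  assumes closed: "\<And>z. z \<in> S \<Longrightarrow> closed {y \<in> S. h y \<le> h z}"
    and compact: "compact {y \<in> S. h y \<le> h w}" and w: "w \<in> S"
  obtains m where "m \<in> S" "\<And>z. z \<in> S \<Longrightarrow> h m \<le> h z"
proof -
  let ?sub = "\<lambda>z. {y \<in> S. h y \<le> h z}"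
  have "?sub w \<inter> \<Inter>(?sub ` S) \<noteq> {}"
  proof (rule compact_imp_fip[OF compact])
    fix \<F> assume "finite \<F>" "\<F> \<subseteq> ?sub ` S"
    then obtain Z where Z: "Z \<subseteq> S" "finite Z" "\<F> = ?sub ` Z"
      by (meson finite_subset_image)
    have "Min (h ` insert w Z) \<in> h ` insert w Z" using Z by (intro Min_in) auto
    then obtain m where m: "m \<in> insert w Z" "h m = Min (h ` insert w Z)"
      by (metis imageE)
    then have "h m \<le> h z" if "z \<in> insert w Z" for z
      using Z that by (simp del: Min_insert image_insert)
    then show "?sub w \<inter> \<Inter>\<F> \<noteq> {}" using m Z w by blast
  qed (use closed in auto)
  then show ?thesis using that by blast
qed

lemma lsc_fun_limit:
  assumes lsc: "lsc_fun h" and u: "u \<longlonglongrightarrow> l" and r: "r \<longlonglongrightarrow> c"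
    and le: "\<And>n. h (u n) \<le> ereal (r n)"
  shows "h l \<le> ereal c"
proof (rule ccontr)
  assume "\<not> h l \<le> ereal c"
  then obtain s where s: "ereal c < ereal s" "ereal s < h l"
    using ereal_dense2 by (metis not_le)
  have "\<forall>\<^sub>F z in at l. ereal s < h z"
    using lsc s(2) unfolding lsc_fun_def le_Liminf_iff by blast
  then have "\<forall>\<^sub>F z in nhds l. ereal s < h z"
    using s(2) by (auto simp: eventually_at_filter elim: eventually_mono)
  then have "\<forall>\<^sub>F n in sequentially. ereal s < h (u n)"
    using u by (rule eventually_compose_filterlim)
  moreover have "\<forall>\<^sub>F n in sequentially. r n < s"
    using order_tendstoD(2)[OF r] s(1) by simp
  ultimately have "\<forall>\<^sub>F n in sequentially. False"
    by eventually_elim (use le in \<open>metis ereal_less_eq(3) less_le_not_le not_less order.strict_trans1\<close>)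
  then show False by simp
qed

lemma closed_sublevel_lsc_add:
  fixes h :: "'a::first_countable_topology \<Rightarrow> ereal" and c :: "'a \<Rightarrow> real"
  assumes lsc: "lsc_fun h" and c: "continuous_on S c" and S: "closed S"
  shows "closed {y \<in> S. h y \<le> ereal (r - c y)}"
  unfolding closed_sequential_limits
proof (intro allI impI, elim conjE)
  fix u l assume u: "\<forall>n. u n \<in> {y \<in> S. h y \<le> ereal (r - c y)}" and lim: "u \<longlonglongrightarrow> l"
  have l: "l \<in> S" using S lim u unfolding closed_sequential_limits by blast
  then have "(\<lambda>n. c (u n)) \<longlonglongrightarrow> c l"
    using u by (intro continuous_on_tendsto_compose[OF c lim]) auto
  then have "(\<lambda>n. r - c (u n)) \<longlonglongrightarrow> r - c l" by (intro tendsto_intros)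
  then show "l \<in> {y \<in> S. h y \<le> ereal (r - c y)}"
    using lsc_fun_limit[OF lsc lim] u l by blast
qed

lemma quadratic_growth_bound:
  fixes s :: real
  assumes "0 < k" "0 \<le> s" "k * s\<^sup>2 \<le> c + A * s"
  shows "s \<le> 1 + (\<bar>c\<bar> + \<bar>A\<bar>) / k"
proof (cases "s \<le> 1")
  case True
  then show ?thesis using assms by (smt (verit) divide_nonneg_pos)
next
  case False
  have "k * s * s \<le> \<bar>c\<bar> * 1 + \<bar>A\<bar> * s"
    using assms by (smt (verit) mult_right_mono power2_eq_square mult.assoc)
  also have "\<dots> \<le> (\<bar>c\<bar> + \<bar>A\<bar>) * s"
    using False by (simp add: distrib_right mult_left_mono del: mult_1_right)
  finally have "k * s \<le> \<bar>c\<bar> + \<bar>A\<bar>" using False by simp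
  then show ?thesis using assms(1) by (simp add: field_simps)
qed

lemma continuous_on_sq_norm [continuous_intros]:
  "continuous_on S u \<Longrightarrow> continuous_on S (\<lambda>y. sq_norm D (u y))"
  unfolding sq_norm_def
  by (intro continuous_on_inner bounded_linear.continuous_on[OF matrix_vector_mul_bounded_linear])

text \<open>Moving from the minimizer \<open>p\<close> towards \<open>z\<close> by a fraction \<open>t\<close> cannot decrease the objective. Dividing by
\<open>t\<close> and letting \<open>t\<close> tend to \<open>0\<close> gives a variational inequality, and the quadratic term
\<open>\<kappa> * sq_norm D (z - p)\<close> is what strong convexity adds. With \<open>\<phi> = 0\<close> and \<open>c = 0\<close> this describes
projections, with \<open>\<phi>\<close> the nonsmooth part of the objective and \<open>c\<close> a gradient it describes
forward-backward steps.\<close>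

lemma prox_three_point:
  assumes conv: "convex_on S \<phi>" and p: "p \<in> S" and z: "z \<in> S" and D: "transpose D = D"
    and min: "\<And>u. u \<in> S \<Longrightarrow>
      \<phi> p + c \<bullet> p + \<kappa> * sq_norm D (p - x) \<le> \<phi> u + c \<bullet> u + \<kappa> * sq_norm D (u - x)"
  shows "\<phi> p + c \<bullet> p + \<kappa> * (sq_norm D (p - x) + sq_norm D (z - p))
    \<le> \<phi> z + c \<bullet> z + \<kappa> * sq_norm D (z - x)"
proof -
  define B where "B = (p - x) \<bullet> (D *v (z - p))"
  define K where "K = \<phi> z - \<phi> p + c \<bullet> (z - p) + 2 * \<kappa> * B"
  have line: "sq_norm D (p + t *\<^sub>R (z - p) - x)
      = sq_norm D (p - x) + 2 * t * B + t\<^sup>2 * sq_norm D (z - p)" for t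
    using sq_norm_add_scaleR[OF D, of "p - x" t "z - p"] by (simp add: B_def diff_add_eq)
  have small: "0 \<le> K + t * (\<kappa> * sq_norm D (z - p))" if t: "0 < t" "t < 1" for t
  proof -
    have eq: "p + t *\<^sub>R (z - p) = (1 - t) *\<^sub>R p + t *\<^sub>R z" by (simp add: algebra_simps)
    have "p + t *\<^sub>R (z - p) \<in> S"
      unfolding eq using t p z by (intro convexD_alt convex_on_imp_convex[OF conv]) auto
    from min[OF this] have "\<phi> p + c \<bullet> p + \<kappa> * sq_norm D (p - x)
        \<le> \<phi> (p + t *\<^sub>R (z - p)) + c \<bullet> p + t * (c \<bullet> (z - p))
          + \<kappa> * (sq_norm D (p - x) + 2 * t * B + t\<^sup>2 * sq_norm D (z - p))"
      by (simp add: line inner_add_right)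
    moreover have "\<phi> (p + t *\<^sub>R (z - p)) \<le> \<phi> p + t * (\<phi> z - \<phi> p)"
      unfolding eq using convex_onD[OF conv, of t p z] t p z by (simp add: algebra_simps)
    ultimately have "0 \<le> t * (K + t * (\<kappa> * sq_norm D (z - p)))"
      by (simp add: K_def power2_eq_square algebra_simps)
    then show ?thesis using t by (simp add: zero_le_mult_iff)
  qed
  have "((\<lambda>t. K + t * (\<kappa> * sq_norm D (z - p))) \<longlongrightarrow> K + 0 * (\<kappa> * sq_norm D (z - p))) (at_right 0)"
    by (intro tendsto_intros)
  moreover have "\<forall>\<^sub>F t in at_right 0. 0 \<le> K + t * (\<kappa> * sq_norm D (z - p))"
    using small eventually_at_right_real[of 0 1] by (auto elim: eventually_mono)
  ultimately have "0 \<le> K"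
    using tendsto_lowerbound trivial_limit_at_right_real by fastforce
  then show ?thesis
    using line[of 1] by (simp add: K_def inner_diff_right algebra_simps)
qed

lemma
  assumes Y: "closed Y" "convex Y" and z: "z \<in> Y"
    and D: "transpose D = D" and \<eta>: "0 < \<eta>" "\<And>u. \<eta> * (norm u)\<^sup>2 \<le> sq_norm D u"
  shows scaled_proj_in: "scaled_proj Y D x \<in> Y"
    and scaled_proj_nonexpansive: "sq_norm D (scaled_proj Y D x - z) \<le> sq_norm D (x - z)"
proof -
  let ?h = "\<lambda>y. sq_norm D (y - x)"
  have closed: "closed {y \<in> Y. ?h y \<le> c}" for c
  proof -
    have "closed {y. ?h y \<le> c}" by (intro closed_Collect_le continuous_intros)
    moreover have "{y \<in> Y. ?h y \<le> c} = Y \<inter> {y. ?h y \<le> c}" by auto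
    ultimately show ?thesis using Y by (simp only: closed_Int)
  qed
  have "bounded {y \<in> Y. ?h y \<le> ?h z}"
  proof (rule bounded_subset[OF bounded_cball])
    show "{y \<in> Y. ?h y \<le> ?h z} \<subseteq> cball x (1 + (\<bar>?h z\<bar> + \<bar>0\<bar>) / \<eta>)"
    proof
      fix y assume "y \<in> {y \<in> Y. ?h y \<le> ?h z}"
      then have "\<eta> * (norm (y - x))\<^sup>2 \<le> ?h z + 0 * norm (y - x)"
        using \<eta>(2)[of "y - x"] by simp
      then have "norm (y - x) \<le> 1 + (\<bar>?h z\<bar> + \<bar>0\<bar>) / \<eta>"
        by (rule quadratic_growth_bound[OF \<eta>(1) norm_ge_zero])
      then show "y \<in> cball x (1 + (\<bar>?h z\<bar> + \<bar>0\<bar>) / \<eta>)"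
        by (simp add: dist_norm norm_minus_commute)
    qed
  qed
  then have "compact {y \<in> Y. ?h y \<le> ?h z}" using closed compact_eq_bounded_closed by blast
  then obtain m where "m \<in> Y" "\<And>u. u \<in> Y \<Longrightarrow> ?h m \<le> ?h u"
    using ex_minimizer_compact_sublevel[of Y ?h z] closed z by blast
  then have "\<exists>m. is_arg_min ?h (\<lambda>u. u \<in> Y) m" by (auto simp: is_arg_min_linorder)
  then have "is_arg_min ?h (\<lambda>u. u \<in> Y) (scaled_proj Y D x)"
    unfolding scaled_proj_def arg_min_on_def arg_min_def by (rule someI_ex)
  then have P: "scaled_proj Y D x \<in> Y" "\<And>u. u \<in> Y \<Longrightarrow> ?h (scaled_proj Y D x) \<le> ?h u"
    by (auto simp: is_arg_min_linorder)
  then show "scaled_proj Y D x \<in> Y" by simp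
  have "convex_on Y (\<lambda>_. 0)" using Y by (simp add: convex_on_def)
  from prox_three_point[OF this P(1) z D, of 0 1 x]
  have "?h (scaled_proj Y D x) + sq_norm D (z - scaled_proj Y D x) \<le> sq_norm D (z - x)"
    using P(2) by simp
  moreover have "0 \<le> ?h (scaled_proj Y D x)"
    using \<eta> by (meson mult_nonneg_nonneg less_imp_le order.trans zero_le_power2)
  ultimately show "sq_norm D (scaled_proj Y D x - z) \<le> sq_norm D (x - z)"
    by (simp add: sq_norm_minus_commute[of D _ z])
qed

section \<open>Smooth functions on a convex set\<close>

text \<open>Derivatives are taken within \<open>Y\<close>, which may have empty interior, so first-order estimates are obtained
from the restriction to segments, where the one-dimensional theory applies.\<close>

lemma has_real_derivative_segment:
  fixes x p :: "'a::real_inner" and \<phi> :: "'a \<Rightarrow> real"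
  assumes Y: "convex Y" "x \<in> Y" "p \<in> Y"
    and deriv: "\<And>u. u \<in> Y \<Longrightarrow> (\<phi> has_derivative (\<lambda>h. G u \<bullet> h)) (at u within Y)"
    and t: "t \<in> {0..1}"
  shows "((\<lambda>s. \<phi> (x + s *\<^sub>R (p - x))) has_real_derivative G (x + t *\<^sub>R (p - x)) \<bullet> (p - x))
    (at t within {0..1})"
proof -
  have seg: "x + s *\<^sub>R (p - x) \<in> Y" if "s \<in> {0..1}" for s
    using convexD_alt[OF Y, of s] that by (simp add: algebra_simps)
  have "((\<lambda>s. x + s *\<^sub>R (p - x)) has_derivative (\<lambda>h. h *\<^sub>R (p - x))) (at t within {0..1})"
    by (auto intro!: derivative_eq_intros)
  moreover have "(\<phi> has_derivative (\<lambda>h. G (x + t *\<^sub>R (p - x)) \<bullet> h))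
      (at (x + t *\<^sub>R (p - x)) within (\<lambda>s. x + s *\<^sub>R (p - x)) ` {0..1})"
    by (rule has_derivative_subset[OF deriv]) (use seg t in auto)
  ultimately have "((\<lambda>s. \<phi> (x + s *\<^sub>R (p - x))) has_derivative
      (\<lambda>h. G (x + t *\<^sub>R (p - x)) \<bullet> (h *\<^sub>R (p - x)))) (at t within {0..1})"
    by (rule has_derivative_in_compose)
  then show ?thesis
    by (simp add: has_field_derivative_def mult_commute_abs)
qed

lemma tangent_below_convex:
  fixes x z :: "'a::real_inner"
  assumes conv: "convex_on Y \<phi>" and xz: "x \<in> Y" "z \<in> Y"
    and deriv: "\<And>u. u \<in> Y \<Longrightarrow> (\<phi> has_derivative (\<lambda>h. G u \<bullet> h)) (at u within Y)"
  shows "\<phi> x + G x \<bullet> (z - x) \<le> \<phi> z"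
proof -
  let ?\<psi> = "\<lambda>s. \<phi> (x + s *\<^sub>R (z - x))"
  have "(?\<psi> has_real_derivative G x \<bullet> (z - x)) (at 0 within {0..1})"
    using has_real_derivative_segment[OF convex_on_imp_convex[OF conv] xz deriv, of 0] by simp
  then have lim: "((\<lambda>s. (?\<psi> s - ?\<psi> 0) / (s - 0)) \<longlongrightarrow> G x \<bullet> (z - x)) (at 0 within {0..1})"
    unfolding has_field_derivative_iff by simp
  have slope: "(?\<psi> s - ?\<psi> 0) / (s - 0) \<le> \<phi> z - \<phi> x" if "0 < s" "s \<le> 1" for s
  proof -
    have "?\<psi> s \<le> (1 - s) * \<phi> x + s * \<phi> z"
      using convex_onD[OF conv, of s x z] that xz by (simp add: algebra_simps)
    then show ?thesis using that by (simp add: field_simps)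
  qed
  have "G x \<bullet> (z - x) \<le> \<phi> z - \<phi> x"
  proof (rule tendsto_upperbound[OF lim])
    show "\<forall>\<^sub>F s in at 0 within {0..1}. (?\<psi> s - ?\<psi> 0) / (s - 0) \<le> \<phi> z - \<phi> x"
      unfolding eventually_at_filter using slope by (intro always_eventually) auto
    show "at (0::real) within {0..1} \<noteq> bot"
      by (simp add: at_within_Icc_at_right)
  qed
  then show ?thesis by simp
qed

lemma descent_lemma:
  fixes x p :: "'a::real_inner"
  assumes Y: "convex Y" "x \<in> Y" "p \<in> Y"
    and deriv: "\<And>u. u \<in> Y \<Longrightarrow> (\<phi> has_derivative (\<lambda>h. G u \<bullet> h)) (at u within Y)"
    and lip: "L-lipschitz_on Y G"
  shows "\<phi> p \<le> \<phi> x + G x \<bullet> (p - x) + L / 2 * (norm (p - x))\<^sup>2"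
proof -
  \<comment> \<open>Up to the constant \<open>\<phi> x\<close>, the first-order remainder along the segment minus its claimed bound.\<close>
  define \<psi> where
    "\<psi> = (\<lambda>s. \<phi> (x + s *\<^sub>R (p - x)) - s * (G x \<bullet> (p - x)) - s\<^sup>2 * (L / 2 * (norm (p - x))\<^sup>2))"
  let ?\<psi>' = "\<lambda>t. G (x + t *\<^sub>R (p - x)) \<bullet> (p - x) - G x \<bullet> (p - x) - t * (L * (norm (p - x))\<^sup>2)"
  have der: "(\<psi> has_real_derivative ?\<psi>' t) (at t within {0..1})" if "t \<in> {0..1}" for t
  proof -
    have lin: "((\<lambda>s. s * c) has_real_derivative c) (at t within {0..1})" for c
      by (auto intro!: derivative_eq_intros)
    have quad: "((\<lambda>s. s\<^sup>2 * c) has_real_derivative 2 * t * c) (at t within {0..1})" for c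
      by (auto intro!: derivative_eq_intros)
    show ?thesis
      unfolding \<psi>_def
      using DERIV_diff[OF DERIV_diff[OF has_real_derivative_segment[OF Y deriv that] lin] quad,
          of "G x \<bullet> (p - x)" "L / 2 * (norm (p - x))\<^sup>2"]
      by simp
  qed
  have "\<psi> 1 \<le> \<psi> 0"
  proof (rule DERIV_nonpos_imp_decreasing_open[OF zero_le_one])
    show "continuous_on {0..1} \<psi>"
      by (rule DERIV_continuous_on) (rule der)
    fix t :: real assume t: "0 < t" "t < 1"
    have seg: "x + t *\<^sub>R (p - x) \<in> Y"
      using convexD_alt[OF Y, of t] t by (simp add: algebra_simps)
    have "(G (x + t *\<^sub>R (p - x)) - G x) \<bullet> (p - x)
        \<le> norm (G (x + t *\<^sub>R (p - x)) - G x) * norm (p - x)"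
      by (rule norm_cauchy_schwarz)
    also have "\<dots> \<le> (L * norm (t *\<^sub>R (p - x))) * norm (p - x)"
      using lipschitz_onD[OF lip seg Y(2)] by (intro mult_right_mono) (auto simp: dist_norm)
    also have "\<dots> = t * (L * (norm (p - x))\<^sup>2)" using t by (simp add: power2_eq_square)
    finally have "?\<psi>' t \<le> 0" by (simp add: inner_diff_left)
    moreover have "(\<psi> has_real_derivative ?\<psi>' t) (at t)"
      using der[of t] t at_within_Icc_at[of 0 t 1] by simp
    ultimately show "\<exists>y. (\<psi> has_real_derivative y) (at t) \<and> y \<le> 0" by blast
  qed
  then show ?thesis by (simp add: \<psi>_def)
qed

section \<open>The forward-backward step\<close>

lemma scaling_matrices_symmetric: "D \<in> scaling_matrices \<eta> \<Longrightarrow> transpose D = D"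
  by (simp add: scaling_matrices_def pos_def_matrix_def)

lemma scaling_matrices_lower: "D \<in> scaling_matrices \<eta> \<Longrightarrow> \<eta> * (norm u)\<^sup>2 \<le> sq_norm D u"
  by (simp add: scaling_matrices_def loewner_le_def sq_norm_def scaleR_matrix_vector_assoc[symmetric]
      power2_norm_eq_inner)

lemma convex_on_real_of_ereal:
  assumes "convex_fun h" "convex S" "S \<subseteq> edom h"
  shows "convex_on S (\<lambda>u. real_of_ereal (h u))"
proof (rule convex_onI)
  fix t u w assume t: "0 < t" "t < (1::real)" and uw: "u \<in> S" "w \<in> S"
  let ?v = "(1 - t) *\<^sub>R u + t *\<^sub>R w"
  have "?v \<in> S" using assms(2) uw t by (intro convexD_alt) auto
  then have fin: "\<bar>h ?v\<bar> \<noteq> \<infinity>" "\<bar>h u\<bar> \<noteq> \<infinity>" "\<bar>h w\<bar> \<noteq> \<infinity>"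
    using assms(3) uw by (auto simp: edom_def)
  have "h ?v \<le> ereal (1 - t) * h u + ereal t * h w"
    using assms(1) t unfolding convex_fun_def by simp
  then show "real_of_ereal (h ?v) \<le> (1 - t) * real_of_ereal (h u) + t * real_of_ereal (h w)"
    using fin by (cases "h ?v"; cases "h u"; cases "h w") auto
qed (use assms in simp)

lemma convex_edom:
  assumes "convex_fun h" "proper_fun h"
  shows "convex (edom h)"
proof (rule convexI)
  fix u w and s t :: real
  assume *: "u \<in> edom h" "w \<in> edom h" "0 \<le> s" "0 \<le> t" "s + t = 1"
  then have "h (s *\<^sub>R u + t *\<^sub>R w) \<le> ereal s * h u + ereal t * h w"
    using assms(1) unfolding convex_fun_def by blast
  also have "\<dots> < \<infinity>" using * by (cases "h u"; cases "h w") (auto simp: edom_def)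
  finally show "s *\<^sub>R u + t *\<^sub>R w \<in> edom h"
    using assms(2) by (auto simp: edom_def proper_fun_def)
qed

locale composite_problem =
  fixes f g :: "real^'n \<Rightarrow> ereal" and G :: "real^'n \<Rightarrow> real^'n" and Y :: "(real^'n) set" and L :: real
  assumes f: "proper_fun f" "convex_fun f"
    and g: "proper_fun g" "convex_fun g" "lsc_fun g"
    and Y: "closed Y" "convex Y" "Y \<subseteq> edom f" "edom g \<subseteq> Y"
    and grad: "gradient_on f G Y" "L > 0" "L-lipschitz_on Y G"
    and g_bdd: "\<exists>m::real. \<forall>z\<in>edom g. ereal m \<le> g z"
begin

definition fr :: "real^'n \<Rightarrow> real" where "fr u = real_of_ereal (f u)"
definition gr :: "real^'n \<Rightarrow> real" where "gr u = real_of_ereal (g u)"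

lemma f_eq: "u \<in> Y \<Longrightarrow> f u = ereal (fr u)"
  using Y(3) by (auto simp: fr_def edom_def ereal_real')

lemma g_eq: "u \<in> edom g \<Longrightarrow> g u = ereal (gr u)"
  by (auto simp: gr_def edom_def ereal_real')

lemma g_top: "u \<notin> edom g \<Longrightarrow> g u = \<infinity>"
  using g(1) by (auto simp: edom_def proper_fun_def)

lemma convex_fr: "convex_on Y fr"
  unfolding fr_def[abs_def] by (rule convex_on_real_of_ereal[OF f(2) Y(2,3)])

lemma convex_gr: "convex_on (edom g) gr"
  unfolding gr_def[abs_def] by (rule convex_on_real_of_ereal[OF g(2) convex_edom[OF g(2,1)] subset_refl])

lemma deriv_fr: "u \<in> Y \<Longrightarrow> (fr has_derivative (\<lambda>h. G u \<bullet> h)) (at u within Y)"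
  unfolding fr_def[abs_def] using grad(1) by (simp add: gradient_on_def)

lemma edom_g_nonempty: "edom g \<noteq> {}"
  using g(1) by (auto simp: proper_fun_def edom_def)

lemma convex_objective: "convex_on (edom g) (\<lambda>u. fr u + gr u)"
  by (rule convex_on_add[OF convex_on_subset[OF convex_fr Y(4) convex_edom[OF g(2,1)]] convex_gr])

lemma closed_sublevel_objective: "closed {u \<in> edom g. fr u + gr u \<le> c}"
proof -
  have "continuous_on Y fr"
    using deriv_fr by (meson continuous_on_eq_continuous_within has_derivative_continuous)
  then have "closed {u \<in> Y. g u \<le> ereal (c - fr u)}"
    by (rule closed_sublevel_lsc_add[OF g(3) _ Y(1)])
  moreover have "{u \<in> Y. g u \<le> ereal (c - fr u)} = {u \<in> edom g. fr u + gr u \<le> c}"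
  proof (intro set_eqI)
    fix u show "u \<in> {u \<in> Y. g u \<le> ereal (c - fr u)} \<longleftrightarrow> u \<in> {u \<in> edom g. fr u + gr u \<le> c}"
    proof (cases "u \<in> edom g")
      case True
      then have "u \<in> Y" using Y(4) by blast
      then show ?thesis using True by (simp add: g_eq algebra_simps)
    next
      case False
      then show ?thesis by (simp add: g_top)
    qed
  qed
  ultimately show ?thesis by simp
qed

lemma is_arg_min_objective_iff:
  "is_arg_min (\<lambda>u. f u + g u) (\<lambda>_. True) z \<longleftrightarrow>
    z \<in> edom g \<and> (\<forall>u\<in>edom g. fr z + gr z \<le> fr u + gr u)"
proof -
  have fin: "f u + g u = ereal (fr u + gr u)" if "u \<in> edom g" for u
    using that Y(4) f_eq g_eq by auto
  have inf: "f u + g u = \<infinity>" if "u \<notin> edom g" for u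
    using g_top[OF that] f(1) by (simp add: proper_fun_def)
  have ex: "\<exists>w. w \<in> edom g" using edom_g_nonempty by blast
  show ?thesis
  proof
    assume "is_arg_min (\<lambda>u. f u + g u) (\<lambda>_. True) z"
    then have min: "f z + g z \<le> f u + g u" for u by (auto simp: is_arg_min_linorder)
    have "z \<in> edom g"
    proof (rule ccontr)
      assume "z \<notin> edom g"
      moreover obtain w where "w \<in> edom g" using ex by blast
      ultimately show False using min[of w] inf[of z] fin[of w] by simp
    qed
    then show "z \<in> edom g \<and> (\<forall>u\<in>edom g. fr z + gr z \<le> fr u + gr u)"
      using min fin by (metis ereal_less_eq(3))
  next
    assume z: "z \<in> edom g \<and> (\<forall>u\<in>edom g. fr z + gr z \<le> fr u + gr u)"
    have "f z + g z \<le> f u + g u" for u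
    proof (cases "u \<in> edom g")
      case True
      then show ?thesis using z fin by simp
    next
      case False
      then have "f u + g u = \<infinity>" by (rule inf)
      then show ?thesis by (simp only: ereal_less_eq)
    qed
    then show "is_arg_min (\<lambda>u. f u + g u) (\<lambda>_. True) z" by (simp add: is_arg_min_linorder)
  qed
qed

context
  fixes D :: "real^'n^'n" and \<eta> :: real
  assumes D: "D \<in> scaling_matrices \<eta>" "0 < \<eta>"
begin

text \<open>The lower bound on \<open>g\<close> and the quadratic term make the sublevel sets of the step objective bounded, so
that a minimizer exists and the step selects one.\<close>

lemma fb_step_minimizes:
  assumes x: "x \<in> Y" and \<alpha>: "0 < \<alpha>"
  defines "p \<equiv> fb_step f G g \<alpha> D x"
  shows "p \<in> edom g"
    and "u \<in> edom g \<Longrightarrow> gr p + G x \<bullet> p + 1 / (2 * \<alpha>) * sq_norm D (p - x)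
      \<le> gr u + G x \<bullet> u + 1 / (2 * \<alpha>) * sq_norm D (u - x)"
proof -
  let ?h = "\<lambda>y. lin f G y x + g y + ereal (1 / (2 * \<alpha>) * sq_norm D (x - y))"
  define q where "q y = fr x + G x \<bullet> (y - x) + 1 / (2 * \<alpha>) * sq_norm D (y - x)" for y
  have h_eq: "?h y = g y + ereal (q y)" for y
    by (cases "g y") (simp_all add: lin_def f_eq[OF x] q_def sq_norm_minus_commute[of D x])
  have h_fin: "?h y = ereal (gr y + q y)" if "y \<in> edom g" for y
    unfolding h_eq using g_eq[OF that] by simp
  have h_inf: "?h y = \<infinity>" if "y \<notin> edom g" for y
    unfolding h_eq using g_top[OF that] by simp
  obtain w where w: "w \<in> edom g" using edom_g_nonempty by blast
  have sub: "{y \<in> UNIV. ?h y \<le> ereal c} = {y \<in> UNIV. g y \<le> ereal (c - q y)}" for c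
  proof -
    have "?h y \<le> ereal c \<longleftrightarrow> g y \<le> ereal (c - q y)" for y
      unfolding h_eq by (cases "g y") auto
    then show ?thesis by simp
  qed
  have closed_real: "closed {y \<in> UNIV. ?h y \<le> ereal c}" for c
    unfolding sub q_def
    by (intro closed_sublevel_lsc_add g(3) continuous_intros closed_UNIV)
  \<comment> \<open>The level may be infinite, in which case the sublevel set is the whole space.\<close>
  have closed: "closed {y \<in> UNIV. ?h y \<le> ?h z}" for z
  proof (cases "z \<in> edom g")
    case True
    show ?thesis unfolding h_fin[OF True] by (rule closed_real)
  next
    case False
    show ?thesis unfolding h_inf[OF False] by simp
  qed
  obtain m where m: "\<And>y. y \<in> edom g \<Longrightarrow> m \<le> gr y"
    using g_bdd g_eq by (metis ereal_less_eq(3))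
  define k where "k = \<eta> / (2 * \<alpha>)"
  have k: "0 < k" using D(2) \<alpha> by (simp add: k_def)
  define c where "c = gr w + q w - m - fr x"
  have "{y \<in> UNIV. ?h y \<le> ?h w} \<subseteq> cball x (1 + (\<bar>c\<bar> + \<bar>norm (G x)\<bar>) / k)"
  proof
    fix y assume "y \<in> {y \<in> UNIV. ?h y \<le> ?h w}"
    then have le: "?h y \<le> ereal (gr w + q w)" by (simp only: h_fin[OF w] mem_Collect_eq)
    then have y: "y \<in> edom g" using h_inf by force
    have "gr y + q y \<le> gr w + q w" using le h_fin[OF y] by simp
    moreover have "k * (norm (y - x))\<^sup>2 \<le> 1 / (2 * \<alpha>) * sq_norm D (y - x)"
      using scaling_matrices_lower[OF D(1), of "y - x"] \<alpha> by (simp add: k_def divide_right_mono)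
    moreover have "- (norm (G x) * norm (y - x)) \<le> G x \<bullet> (y - x)"
      using Cauchy_Schwarz_ineq2[of "G x" "y - x"] by linarith
    ultimately have "k * (norm (y - x))\<^sup>2 \<le> c + norm (G x) * norm (y - x)"
      using m[OF y] unfolding c_def q_def[of y] by linarith
    from quadratic_growth_bound[OF k norm_ge_zero this]
    show "y \<in> cball x (1 + (\<bar>c\<bar> + \<bar>norm (G x)\<bar>) / k)"
      by (simp add: dist_norm norm_minus_commute)
  qed
  then have "bounded {y \<in> UNIV. ?h y \<le> ?h w}" by (rule bounded_subset[OF bounded_cball])
  then have cpt: "compact {y \<in> UNIV. ?h y \<le> ?h w}"
    unfolding compact_eq_bounded_closed using closed by (rule conjI)
  obtain p0 where "p0 \<in> UNIV" "\<And>z. z \<in> UNIV \<Longrightarrow> ?h p0 \<le> ?h z"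
    by (rule ex_minimizer_compact_sublevel[OF closed cpt UNIV_I]) (rule that)
  then have "\<exists>p0. is_arg_min ?h (\<lambda>_. True) p0" by (auto simp: is_arg_min_linorder)
  then have "is_arg_min ?h (\<lambda>_. True) p"
    unfolding p_def fb_step_def arg_min_def by (rule someI_ex)
  then have min: "?h p \<le> ?h z" for z by (simp only: is_arg_min_linorder)
  show p: "p \<in> edom g"
  proof (rule ccontr)
    assume np: "p \<notin> edom g"
    from min[of w] show False unfolding h_inf[OF np] h_fin[OF w] by simp
  qed
  assume "u \<in> edom g"
  from min[of u] have "gr p + q p \<le> gr u + q u"
    unfolding h_fin[OF \<open>u \<in> edom g\<close>] h_fin[OF p] by simp
  then show "gr p + G x \<bullet> p + 1 / (2 * \<alpha>) * sq_norm D (p - x)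
      \<le> gr u + G x \<bullet> u + 1 / (2 * \<alpha>) * sq_norm D (u - x)"
    by (simp add: q_def inner_diff_right)
qed

lemma sufficient_decrease_iff:
  assumes x: "x \<in> Y" and \<alpha>: "0 < \<alpha>"
  defines "p \<equiv> fb_step f G g \<alpha> D x"
  shows "sufficient_decrease f G g \<alpha> D x \<longleftrightarrow>
    fr p \<le> fr x + G x \<bullet> (p - x) + 1 / (2 * \<alpha>) * sq_norm D (p - x)"
proof -
  have "p \<in> Y" using fb_step_minimizes(1)[OF x \<alpha>] Y(4) by (auto simp: p_def)
  then show ?thesis
    unfolding sufficient_decrease_def Let_def p_def[symmetric] lin_def
    by (simp add: f_eq x sq_norm_minus_commute[of D x])
qed

text \<open>The three-point inequality bounds \<open>g\<close> at the new point, the line search criterion bounds \<open>f\<close> there by its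
linearisation, and convexity bounds this linearisation at \<open>z\<close> by \<open>f\<close>; the gradient terms cancel.\<close>

lemma fb_step_inequality:
  assumes x: "x \<in> Y" and \<alpha>: "0 < \<alpha>" and z: "z \<in> edom g"
    and decrease: "sufficient_decrease f G g \<alpha> D x"
  defines "p \<equiv> fb_step f G g \<alpha> D x"
  shows "\<alpha> * (fr p + gr p) + sq_norm D (p - z) / 2 \<le> \<alpha> * (fr z + gr z) + sq_norm D (x - z) / 2"
proof -
  define \<kappa> where "\<kappa> = 1 / (2 * \<alpha>)"
  have "gr p + G x \<bullet> p + \<kappa> * (sq_norm D (p - x) + sq_norm D (z - p))
      \<le> gr z + G x \<bullet> z + \<kappa> * sq_norm D (z - x)"
    using prox_three_point[OF convex_gr _ z scaling_matrices_symmetric[OF D(1)],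
        of p "G x" "\<kappa>" x] fb_step_minimizes[OF x \<alpha>]
    by (simp add: p_def \<kappa>_def)
  moreover have "fr x + G x \<bullet> (z - x) \<le> fr z"
    by (rule tangent_below_convex[OF convex_fr x _ deriv_fr]) (use z Y(4) in auto)
  moreover have "fr p \<le> fr x + G x \<bullet> (p - x) + \<kappa> * sq_norm D (p - x)"
    using decrease sufficient_decrease_iff[OF x \<alpha>] by (simp add: p_def \<kappa>_def)
  ultimately have "(fr p + gr p) + \<kappa> * sq_norm D (z - p)
      \<le> (fr z + gr z) + \<kappa> * sq_norm D (z - x)"
    unfolding inner_diff_right distrib_left by linarith
  then have "\<alpha> * ((fr p + gr p) + \<kappa> * sq_norm D (z - p))
      \<le> \<alpha> * ((fr z + gr z) + \<kappa> * sq_norm D (z - x))"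
    using \<alpha> by (intro mult_left_mono) auto
  then show ?thesis
    using \<alpha> by (simp add: \<kappa>_def distrib_left[of \<alpha> "_ + _"] sq_norm_minus_commute[of D _ z])
qed

lemma sufficient_decrease_small_step:
  assumes x: "x \<in> Y" and \<alpha>: "0 < \<alpha>" "\<alpha> \<le> \<eta> / L"
  shows "sufficient_decrease f G g \<alpha> D x"
proof -
  define p where "p = fb_step f G g \<alpha> D x"
  have "p \<in> Y" using fb_step_minimizes(1)[OF x \<alpha>(1)] Y(4) by (auto simp: p_def)
  then have "fr p \<le> fr x + G x \<bullet> (p - x) + L / 2 * (norm (p - x))\<^sup>2"
    by (rule descent_lemma[OF Y(2) x _ deriv_fr grad(3)])
  also have "L / 2 * (norm (p - x))\<^sup>2 \<le> 1 / (2 * \<alpha>) * (\<eta> * (norm (p - x))\<^sup>2)"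
  proof -
    have "L / 2 \<le> 1 / (2 * \<alpha>) * \<eta>" using \<alpha> grad(2) by (simp add: field_simps)
    then show ?thesis by (metis mult.assoc mult_right_mono zero_le_power2)
  qed
  also have "\<dots> \<le> 1 / (2 * \<alpha>) * sq_norm D (p - x)"
    using scaling_matrices_lower[OF D(1)] \<alpha> by (intro mult_left_mono) auto
  finally show ?thesis using sufficient_decrease_iff[OF x \<alpha>(1)] by (simp add: p_def)
qed

text \<open>Every trial steplength up to \<open>\<eta> / L\<close> is accepted. If backtracking happens at all, the last rejected
steplength thus exceeded \<open>\<eta> / L\<close>, and the accepted one is \<open>\<delta>\<close> times as large.\<close>

lemma line_search:
  assumes x: "x \<in> Y" and \<alpha>: "0 < \<alpha>" and \<delta>: "0 < \<delta>" "\<delta> < 1"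
  defines "\<alpha>' \<equiv> \<delta> ^ (LEAST i. sufficient_decrease f G g (\<delta> ^ i * \<alpha>) D x) * \<alpha>"
  shows "sufficient_decrease f G g \<alpha>' D x" "0 < \<alpha>'" "\<alpha>' \<le> \<alpha>" "min \<alpha> (\<delta> * (\<eta> / L)) \<le> \<alpha>'"
proof -
  let ?P = "\<lambda>i. sufficient_decrease f G g (\<delta> ^ i * \<alpha>) D x"
  define N where "N = (LEAST i. ?P i)"
  have \<alpha>': "\<alpha>' = \<delta> ^ N * \<alpha>" by (simp add: \<alpha>'_def N_def)
  have small: "?P i" if "\<delta> ^ i * \<alpha> \<le> \<eta> / L" for i
    by (rule sufficient_decrease_small_step[OF x _ that]) (use \<alpha> \<delta> in simp)
  have "0 < \<eta> / L / \<alpha>" using D(2) grad(2) \<alpha> by simp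
  then obtain i where "\<delta> ^ i < \<eta> / L / \<alpha>" using real_arch_pow_inv \<delta>(2) by blast
  then have "\<delta> ^ i * \<alpha> \<le> \<eta> / L" 
    by (simp only: pos_less_divide_eq[OF \<alpha>] less_imp_le)
  then have "?P i" by (rule small)
  then show "sufficient_decrease f G g \<alpha>' D x"
    unfolding \<alpha>' N_def by (rule LeastI)
  show "0 < \<alpha>'" using \<alpha> \<delta> by (simp add: \<alpha>')
  show "\<alpha>' \<le> \<alpha>" using \<alpha> \<delta> by (simp add: \<alpha>' mult_left_le_one_le power_le_one)
  show "min \<alpha> (\<delta> * (\<eta> / L)) \<le> \<alpha>'"
  proof (cases N)
    case 0
    then show ?thesis by (simp add: \<alpha>')
  next
    case (Suc j)
    then have "\<not> ?P j" using not_less_Least[of j ?P] by (simp add: N_def)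
    then have "\<eta> / L < \<delta> ^ j * \<alpha>" by (meson not_le small)
    then have "\<delta> * (\<eta> / L) \<le> \<delta> * (\<delta> ^ j * \<alpha>)" using \<delta>(1) by (intro mult_left_mono) auto
    then show ?thesis by (simp add: \<alpha>' Suc mult.assoc min_le_iff_disj)
  qed
qed

end

end

section \<open>Convergence of the method\<close>

lemma summable_weighted_bigo:
  assumes p: "2 < p" and s: "s \<in> O(\<lambda>k. 1 / real k powr p)"
  shows "summable (\<lambda>k. real k * s k :: real)"
proof (rule summable_comparison_test_bigo)
  have "summable (\<lambda>k. real k powr (1 - p))" using p by (simp add: summable_real_powr_iff)
  then show "summable (\<lambda>k. norm (real k powr (1 - p)))" by simp
  have "(\<lambda>k. real k * s k) \<in> O(\<lambda>k. real k * (1 / real k powr p))"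
    by (intro landau_o.big.mult_left s)
  also have "(\<lambda>k. real k * (1 / real k powr p)) = (\<lambda>k. real k powr (1 - p))"
  proof
    fix k show "real k * (1 / real k powr p) = real k powr (1 - p)"
      by (cases "k = 0") (simp_all add: powr_diff)
  qed
  finally show "(\<lambda>k. real k * s k) \<in> O(\<lambda>k. real k powr (1 - p))" .
qed

theorem theorem3p2:
  fixes f g :: "real^'n \<Rightarrow> ereal"
    and G :: "real^'n \<Rightarrow> real^'n"
    and Y :: "(real^'n) set"
    and D :: "nat \<Rightarrow> real^'n^'n"
    and x y :: "nat \<Rightarrow> real^'n"
    and \<alpha> \<beta> \<theta> \<eta>s \<nu>s :: "nat \<Rightarrow> real"
    and L \<eta> \<gamma> \<alpha>\<^sub>0 \<delta> a p :: real
  assumes f: "proper_fun f" "convex_fun f" "lsc_fun f"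
    and g: "proper_fun g" "convex_fun g" "lsc_fun g"
    and Y: "closed Y" "convex Y" "Y \<subseteq> edom f" "edom g \<subseteq> Y"
    and grad: "gradient_on f G Y" "L > 0" "L-lipschitz_on Y G"
    and g_bdd: "\<exists>m::real. \<forall>z\<in>edom g. ereal m \<le> g z"
    and solvable: "\<exists>z. is_arg_min (\<lambda>u. f u + g u) (\<lambda>_. True) z"
    and params: "\<alpha>\<^sub>0 > 0" "0 < \<delta>" "\<delta> < 1"
    and a: "a > 2"
    and theta: "\<theta> 0 = 1" "\<forall>k\<ge>1. \<theta> k = a / (real k + a)"
    and beta: "\<beta> 0 = 0" "\<forall>k\<ge>1. \<beta> k = (real k - 1) / (real k + a)"
    and scaling: "\<eta> > 0" "\<forall>k. D k \<in> scaling_matrices \<eta>"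
      "bdd_above (range (\<lambda>k. onorm ((*v) (D k))))"
      "(SUP k. onorm ((*v) (D k))) = \<gamma>"
    and change: "\<forall>k. D (Suc k) \<preceq> (1 + \<eta>s k) *\<^sub>R D k"
      "\<forall>k. D k \<preceq> (1 + \<nu>s k) *\<^sub>R D (Suc k)"
    and etas: "\<forall>k. \<eta>s k \<ge> 0" "summable \<eta>s" "\<eta>s \<in> O(\<lambda>k. 1 / real k powr p)"
    and nus: "\<forall>k. \<nu>s k \<ge> 0" "summable \<nu>s" "\<nu>s \<in> O(\<lambda>k. 1 / real k powr p)"
    and p: "p > 2"
    and alg: "generated_by_SIFB f G g Y \<alpha>\<^sub>0 \<delta> \<beta> D \<alpha> y x"
  shows "\<exists>z. is_arg_min (\<lambda>u. f u + g u) (\<lambda>_. True) z \<and> x \<longlonglongrightarrow> z"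
proof -
  interpret composite_problem f g G Y L
    by unfold_locales (use f g Y grad g_bdd in auto)
  define C where "C = edom g"
  define F where "F u = fr u + gr u" for u
  define P where "P k = x k + \<beta> k *\<^sub>R (x k - prev (x 0) x k)" for k
  define \<alpha>\<^sub>m where "\<alpha>\<^sub>m = min \<alpha>\<^sub>0 (\<delta> * (\<eta> / L))"
  have x0: "x 0 \<in> Y"
    and y: "\<And>k. y k = scaled_proj Y (D k) (P k)"
    and \<alpha>: "\<And>k. \<alpha> k = \<delta> ^ (LEAST i. sufficient_decrease f G g (\<delta> ^ i * prev \<alpha>\<^sub>0 \<alpha> k) (D k) (y k))
                * prev \<alpha>\<^sub>0 \<alpha> k"
    and x_Suc: "\<And>k. x (Suc k) = fb_step f G g (\<alpha> k) (D k) (y k)"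
    using alg unfolding generated_by_SIFB_def P_def by blast+
  have Dk: "D k \<in> scaling_matrices \<eta>" for k using scaling(2) by blast
  note sym = scaling_matrices_symmetric[OF Dk] and lower = scaling_matrices_lower[OF Dk]
  have yY: "y k \<in> Y" for k
    unfolding y by (rule scaled_proj_in[OF Y(1,2) x0 sym scaling(1) lower])
  have \<alpha>m: "0 < \<alpha>\<^sub>m" using params scaling(1) grad(2) by (simp add: \<alpha>\<^sub>m_def)
  have ls: "sufficient_decrease f G g (\<alpha> k) (D k) (y k)" "0 < \<alpha> k" "\<alpha> k \<le> prev \<alpha>\<^sub>0 \<alpha> k"
      "min (prev \<alpha>\<^sub>0 \<alpha> k) (\<delta> * (\<eta> / L)) \<le> \<alpha> k"
    if "0 < prev \<alpha>\<^sub>0 \<alpha> k" for k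
    using line_search[OF Dk[of k] scaling(1) yY[of k] that params(2,3), folded \<alpha>] by simp_all
  have prev_ge: "\<alpha>\<^sub>m \<le> prev \<alpha>\<^sub>0 \<alpha> k" for k
  proof (induction k)
    case 0
    show ?case by (simp add: prev_def \<alpha>\<^sub>m_def)
  next
    case (Suc k)
    have "prev \<alpha>\<^sub>0 \<alpha> (Suc k) = \<alpha> k" by (simp add: prev_def)
    moreover have "0 < prev \<alpha>\<^sub>0 \<alpha> k" using Suc \<alpha>m by linarith
    ultimately show ?case using ls(4)[of k] Suc unfolding \<alpha>\<^sub>m_def by linarith
  qed
  then have prev_pos: "0 < prev \<alpha>\<^sub>0 \<alpha> k" for k using \<alpha>m order.strict_trans2 by blast
  have x_in: "x (Suc k) \<in> C" for k
    unfolding x_Suc C_def by (rule fb_step_minimizes(1)[OF Dk scaling(1) yY ls(2)[OF prev_pos]])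
  have step: "\<alpha> k * F (x (Suc k)) + sq_norm (D k) (x (Suc k) - u) / 2
      \<le> \<alpha> k * F u + sq_norm (D k) (P k - u) / 2" if u: "u \<in> C" for k u
  proof -
    have "\<alpha> k * F (x (Suc k)) + sq_norm (D k) (x (Suc k) - u) / 2
        \<le> \<alpha> k * F u + sq_norm (D k) (y k - u) / 2"
      unfolding x_Suc F_def
      using fb_step_inequality[OF Dk scaling(1) yY ls(2)[OF prev_pos] _ ls(1)[OF prev_pos]] u
      by (simp add: C_def)
    moreover have "sq_norm (D k) (y k - u) \<le> sq_norm (D k) (P k - u)"
      unfolding y using scaled_proj_nonexpansive[OF Y(1,2) _ sym scaling(1) lower] u Y(4)
      by (auto simp: C_def)
    ultimately show ?thesis by linarith
  qed
  have upper: "sq_norm (D k) u \<le> \<gamma> * (norm u)\<^sup>2" for k u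
  proof -
    have "sq_norm (D k) u \<le> norm u * norm (D k *v u)"
      unfolding sq_norm_def by (rule norm_cauchy_schwarz)
    also have "\<dots> \<le> norm u * (onorm ((*v) (D k)) * norm u)"
      by (intro mult_left_mono onorm matrix_vector_mul_bounded_linear) auto
    also have "\<dots> \<le> norm u * (\<gamma> * norm u)"
      unfolding scaling(4)[symmetric]
      by (intro mult_left_mono mult_right_mono cSUP_upper scaling(3)) auto
    finally show ?thesis by (simp add: power2_eq_square mult_ac)
  qed
  have loewner: "sq_norm A u \<le> c * sq_norm B u" if "A \<preceq> c *\<^sub>R B" for A B :: "real^'n^'n" and c u
    using that by (simp add: loewner_le_def sq_norm_def scaleR_matrix_vector_assoc[symmetric])
  have sums: "summable (\<lambda>n. real (Suc n) * s (Suc n))" if "s \<in> O(\<lambda>k. 1 / real k powr p)" for s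
    using summable_weighted_bigo[OF p that] by (subst summable_Suc_iff)
  \<comment> \<open>At \<open>n = 0\<close> both inertial coefficients vanish, although the directions that they multiply differ.\<close>
  have P_Suc: "P (Suc n) = x (Suc n) + (n / (n + (a + 1))) *\<^sub>R (x (Suc n) - x (Suc (n - 1)))" for n
    using beta(2) by (cases n) (simp_all add: P_def prev_def add_ac)
  \<comment> \<open>The comparison starts at \<open>x 1\<close>, the first iterate at which \<open>g\<close> is known to be finite.\<close>
  interpret S: scaled_inertial_sequence F C "\<lambda>n. x (Suc n)" "\<lambda>n. D (Suc n)" "\<lambda>n. \<alpha> (Suc n)"
    "\<lambda>n. \<eta>s (Suc n)" "\<lambda>n. \<nu>s (Suc n)" "a + 1" \<eta> \<gamma> \<alpha>\<^sub>m
  proof unfold_locales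
    show "3 < a + 1" using a by simp
    show "convex_on C F" unfolding F_def[abs_def] C_def by (rule convex_objective)
    show "closed {u \<in> C. F u \<le> c}" for c unfolding F_def C_def by (rule closed_sublevel_objective)
    show "\<alpha>\<^sub>m \<le> \<alpha> (Suc n)" for n using prev_ge[of "Suc (Suc n)"] by (simp add: prev_def)
    show "\<alpha> (Suc (Suc n)) \<le> \<alpha> (Suc n)" for n
      using ls(3)[OF prev_pos, of "Suc (Suc n)"] by (simp add: prev_def)
    show "\<alpha> (Suc n) * F (x (Suc (Suc n))) + sq_norm (D (Suc n)) (x (Suc (Suc n)) - u) / 2
        \<le> \<alpha> (Suc n) * F u + sq_norm (D (Suc n)) (x (Suc n)
          + (real n / (real n + (a + 1))) *\<^sub>R (x (Suc n) - x (Suc (n - 1))) - u) / 2"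
      if "u \<in> C" for n u
      using step[OF that, of "Suc n"] unfolding P_Suc .
  qed (use scaling(1) sym lower upper loewner change etas nus sums \<alpha>m x_in in auto)
  have iff: "is_arg_min (\<lambda>u. f u + g u) (\<lambda>_. True) z \<longleftrightarrow> z \<in> S.minimizers" for z
    unfolding is_arg_min_objective_iff S.minimizers_def by (simp add: F_def C_def)
  have "S.minimizers \<noteq> {}" using solvable iff by blast
  then obtain l where "l \<in> S.minimizers" "(\<lambda>n. x (Suc n)) \<longlonglongrightarrow> l"
    by (rule S.converges_to_minimizer)
  then show ?thesis using iff LIMSEQ_imp_Suc by blast
qed

end
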